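(* A pair of curves $(C,C^\ast)$ in $E^3$, with $C:\varphi(s)$ and $C^\ast:\psi(s^\ast)$ parametrized by arc lengths $s$ and $s^\ast$ respectively, is a Mannheim pair (with $C$ the Mannheim curve and $C^\ast$ its Mannheim partner curve) if and only if the curvature $\kappa_\psi$ and the torsion $\tau_\psi$ of $C^\ast$ satisfy $$\tau_\psi'=\frac{d\tau_\psi}{ds^\ast}=\frac{\kappa_\psi}{a}\left(1+a^2\tau_\psi^2\right),$$ where $a$ is a nonzero constant.
   Context: $E^3$ is Euclidean 3-space with its standard inner product. Curves are analytic, parametrized by arc length, and the curvature $\kappa$ is not identically zero (its zeros are discrete). The modified orthogonal frame of such a curve $\varphi$ is $T=\frac{d\varphi}{ds}$, $N=\frac{dT}{ds}$, $B=T\times N$. At points with $\kappa\neq 0$, $T=t$, $N=\kappa n$, $B=\kappa b$, where $\{t,n,b\}$ is the Frenet frame, and $$T'=N,\qquad N'=-\kappa^2T+\frac{\kappa'}{\kappa}N+\tau B,\qquad B'=-\tau N+\frac{\kappa'}{\kappa}B,$$ where $\tau=\det(\varphi',\varphi'',\varphi''')/\kappa^2$ is the torsion (zeros of $\kappa$ are removable singularities of $\tau$). Subscripts $\varphi,\psi$ indicate the curve to which a quantity belongs. Mannheim pair: let $\varphi$ and $\psi$ be two space curves in $E^3$ with a correspondence between their points such that, at corresponding points, the principal normal line of $\varphi$ coincides with the binormal line of $\psi$. Then $\varphi$ is called a Mannheim curve, $\psi$ a Mannheim partner curve of $\varphi$, and $\{\varphi,\psi\}$ a Mannheim pair.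
   Formalization: C is quantified existentially: C* has some Mannheim curve C iff the equation holds (for an arbitrary given C the "if" part is false); the curvature of C* is the analytic, possibly sign-changing root of |ψ''|², since with |ψ''| the "only if" part fails at odd zeros. *)

theory Defs
  imports "HOL-Analysis.Analysis"
begin

definition real_analytic_on :: "real set \<Rightarrow> (real \<Rightarrow> 'a::real_normed_vector) \<Rightarrow> bool" where
  "real_analytic_on I f \<longleftrightarrow>
     (\<forall>s\<in>I. \<exists>r>0. \<exists>c. \<forall>t. \<bar>t - s\<bar> < r \<longrightarrow> (\<lambda>n. (t - s) ^ n *\<^sub>R c n) sums f t)"

text \<open>The modified orthogonal frame of a curve; \<open>N\<close> and \<open>B\<close> are not normalised
  and vanish exactly where the curvature does.\<close>

definition frame_T :: "(real \<Rightarrow> real ^ 3) \<Rightarrow> real \<Rightarrow> real ^ 3" where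
  "frame_T \<gamma> s = vector_derivative \<gamma> (at s)"

definition frame_N :: "(real \<Rightarrow> real ^ 3) \<Rightarrow> real \<Rightarrow> real ^ 3" where
  "frame_N \<gamma> s = vector_derivative (frame_T \<gamma>) (at s)"

definition frame_B :: "(real \<Rightarrow> real ^ 3) \<Rightarrow> real \<Rightarrow> real ^ 3" where
  "frame_B \<gamma> s = cross3 (frame_T \<gamma> s) (frame_N \<gamma> s)"

definition arclength_curve :: "real set \<Rightarrow> (real \<Rightarrow> real ^ 3) \<Rightarrow> bool" where
  "arclength_curve I \<gamma> \<longleftrightarrow>
     open I \<and> is_interval I \<and> I \<noteq> {} \<and> real_analytic_on I \<gamma> \<and>
     (\<forall>s\<in>I. norm (frame_T \<gamma> s) = 1) \<and> (\<exists>s\<in>I. frame_N \<gamma> s \<noteq> 0)"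

text \<open>The curvature is taken as an analytic function with \<open>\<kappa>\<^sup>2 = \<langle>N, N\<rangle>\<close>, which
  is determined up to a global sign. Where \<open>N\<close> does not vanish this is the usual
  \<open>norm N\<close> (up to that sign). At a zero of odd order \<open>norm N\<close> is not differentiable
  and \<open>\<kappa>\<close> changes sign there, so that \<open>N = \<kappa> n\<close> and \<open>B = \<kappa> b\<close> with \<open>n\<close> and \<open>b\<close>
  analytic along the whole curve.\<close>

definition is_curvature :: "real set \<Rightarrow> (real \<Rightarrow> real ^ 3) \<Rightarrow> (real \<Rightarrow> real) \<Rightarrow> bool" where
  "is_curvature I \<gamma> \<kappa> \<longleftrightarrow>
     real_analytic_on I \<kappa> \<and> (\<forall>s\<in>I. (\<kappa> s)\<^sup>2 = frame_N \<gamma> s \<bullet> frame_N \<gamma> s)"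

definition torsion_quotient :: "(real \<Rightarrow> real ^ 3) \<Rightarrow> real \<Rightarrow> real" where
  "torsion_quotient \<gamma> s =
     det (vector [frame_T \<gamma> s, frame_N \<gamma> s, vector_derivative (frame_N \<gamma>) (at s)] :: real ^ 3 ^ 3)
       / (norm (frame_N \<gamma> s))\<^sup>2"

text \<open>The zeros of the curvature are removable singularities of the torsion, which is
  extended there by its limit.\<close>

definition torsion :: "(real \<Rightarrow> real ^ 3) \<Rightarrow> real \<Rightarrow> real" where
  "torsion \<gamma> s =
     (if frame_N \<gamma> s \<noteq> 0 then torsion_quotient \<gamma> s else Lim (at s) (torsion_quotient \<gamma>))"

definition principal_normal_line :: "(real \<Rightarrow> real ^ 3) \<Rightarrow> real \<Rightarrow> (real ^ 3) set" where
  "principal_normal_line \<gamma> s = {\<gamma> s + u *\<^sub>R frame_N \<gamma> s | u. True}"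

definition binormal_line :: "(real \<Rightarrow> real ^ 3) \<Rightarrow> real \<Rightarrow> (real ^ 3) set" where
  "binormal_line \<gamma> s = {\<gamma> s + u *\<^sub>R frame_B \<gamma> s | u. True}"

text \<open>\<open>\<phi>\<close> is the Mannheim curve and \<open>\<psi>\<close> its partner. The correspondence \<open>h\<close> sends the arc
  length of \<open>\<psi>\<close> to that of \<open>\<phi>\<close>. The two lines are compared wherever both exist: the sets
  above degenerate to points at the isolated zeros of the curvatures.\<close>

definition mannheim_pair ::
    "real set \<Rightarrow> (real \<Rightarrow> real ^ 3) \<Rightarrow> real set \<Rightarrow> (real \<Rightarrow> real ^ 3) \<Rightarrow> bool" where
  "mannheim_pair I \<phi> J \<psi> \<longleftrightarrow>
     arclength_curve I \<phi> \<and> arclength_curve J \<psi> \<and>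
     (\<exists>h. bij_betw h J I \<and> h differentiable_on J \<and>
        (\<forall>s\<in>J. frame_N \<phi> (h s) \<noteq> 0 \<longrightarrow> frame_B \<psi> s \<noteq> 0 \<longrightarrow>
           principal_normal_line \<phi> (h s) = binormal_line \<psi> s))"

end

theory Submission
  imports Defs "HOL-Complex_Analysis.Complex_Analysis"
begin

text \<open>
  Write \<open>t\<close>, \<open>n\<close>, \<open>b\<close> for the Frenet frame of \<open>\<psi>\<close> and \<open>T\<close>, \<open>N\<close> for the tangent and the
  normal of \<open>\<phi>\<close> at the corresponding point. If the principal normal line of \<open>\<phi>\<close> is the
  binormal line of \<open>\<psi>\<close>, then \<open>\<phi> = \<psi> + a b\<close> for some function \<open>a\<close>. Both tangents are orthogonal to
  \<open>b\<close>, which forces \<open>a\<close> to be constant, and differentiation along \<open>\<psi>\<close> shows that \<open>T\<close> is a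
  multiple of \<open>t - a \<tau> n\<close>. So, up to sign, \<open>T = cos \<theta> t - sin \<theta> n\<close> with \<open>tan \<theta> = a \<tau>\<close>, and
  \<open>T' = (\<kappa> - \<theta>') (sin \<theta> t + cos \<theta> n) - \<tau> sin \<theta> b\<close> by the Frenet formulas, where
  the prime is the derivative along \<open>\<psi>\<close>. This is a multiple of
  \<open>b\<close> exactly when \<open>\<theta>' = \<kappa>\<close>, and \<open>\<theta>' = \<kappa>\<close> is the stated equation
  \<open>\<tau>' = \<kappa> (1 + a\<^sup>2 \<tau>\<^sup>2) / a\<close> because \<open>tan \<theta> = a \<tau>\<close>. Both implications,
  \<open>mannheim_imp_torsion_ode\<close> and \<open>torsion_ode_imp_mannheim\<close>, read this computation in one
  direction; they use \<open>cos \<theta>\<close> and \<open>sin \<theta>\<close> up to sign through their algebraic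
  expressions in \<open>\<tau>\<close> and never choose an angle.

  The rest concerns the zeros of the curvatures. First, the Frenet formulas have to hold across
  the zeros of \<open>\<kappa>\<close>: since the normal vector of \<open>\<psi>\<close> has length \<open>\<bar>\<kappa>\<bar>\<close>, each of its components is
  divisible by \<open>\<kappa>\<close> in the ring of analytic germs, so that \<open>n\<close> and \<open>b\<close> are analytic everywhere
  (\<open>frenet_curve_exists\<close>) and the torsion is \<open>n' \<bullet> b\<close> even where it is defined by a limit
  (\<open>torsion_eq\<close>). Secondly, the lines are compared only where neither curvature vanishes.
  The excluded points are isolated by the identity theorem, and an equation between
  continuous functions passes to an isolated point (\<open>isCont_eq_zeroI\<close>). Thirdly, the curve
  \<open>\<psi> + a b\<close> is not parametrized by arc length, so the analyticity of the arc length function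
  and of its inverse is needed.

  Real analytic germs are handled through their holomorphic extensions, which turns
  statements about quotients, composition, primitives and inverses into known facts of
  complex analysis.
\<close>

section \<open>Real analytic functions as restrictions of holomorphic functions\<close>

definition real_analytic_at :: "(real \<Rightarrow> real) \<Rightarrow> real \<Rightarrow> bool" where
  "real_analytic_at f s \<longleftrightarrow>
     (\<exists>F. F analytic_on {complex_of_real s} \<and> (\<forall>\<^sub>F t in nhds s. F (of_real t) = of_real (f t)))"

lemma real_analytic_atI:
  assumes "F analytic_on {complex_of_real s}" "\<forall>\<^sub>F t in nhds s. F (of_real t) = of_real (f t)"
  shows "real_analytic_at f s"
  using assms by (auto simp: real_analytic_at_def)

lemma real_analytic_atE:
  assumes "real_analytic_at f s"
  obtains r F where "r > 0" "F holomorphic_on ball (complex_of_real s) r"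
    "\<And>t. \<bar>t - s\<bar> < r \<Longrightarrow> F (of_real t) = of_real (f t)"
proof -
  obtain F where F: "F analytic_on {complex_of_real s}"
    and ev: "\<forall>\<^sub>F t in nhds s. F (of_real t) = of_real (f t)"
    using assms by (auto simp: real_analytic_at_def)
  obtain e where e: "e > 0" "F holomorphic_on ball (complex_of_real s) e"
    using F analytic_at_ball by blast
  obtain d where d: "d > 0" "\<And>t. dist t s < d \<Longrightarrow> F (of_real t) = of_real (f t)"
    using ev by (auto simp: eventually_nhds_metric)
  show ?thesis
    by (rule that[of "min d e" F]) (use d e in \<open>auto simp: dist_real_def intro: holomorphic_on_subset\<close>)
qed

lemma real_analytic_at_cong:
  assumes "real_analytic_at f s" "\<forall>\<^sub>F t in nhds s. g t = f t"
  shows "real_analytic_at g s"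
proof -
  obtain F where F: "F analytic_on {complex_of_real s}"
    and ev: "\<forall>\<^sub>F t in nhds s. F (of_real t) = of_real (f t)"
    using assms(1) by (auto simp: real_analytic_at_def)
  have "\<forall>\<^sub>F t in nhds s. F (of_real t) = of_real (g t)"
    using ev assms(2) by eventually_elim simp
  with F show ?thesis by (rule real_analytic_atI)
qed

lemma real_analytic_at_const: "real_analytic_at (\<lambda>_. c) s"
  by (rule real_analytic_atI[of "\<lambda>_. of_real c"]) auto

lemma real_analytic_at_ident: "real_analytic_at (\<lambda>t. t) s"
  by (rule real_analytic_atI[of "\<lambda>z. z"]) auto

lemma real_analytic_at_add:
  assumes "real_analytic_at f s" "real_analytic_at g s"
  shows "real_analytic_at (\<lambda>t. f t + g t) s"
proof -
  from assms obtain F G where "F analytic_on {complex_of_real s}" "G analytic_on {complex_of_real s}"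
    and ev: "\<forall>\<^sub>F t in nhds s. F (of_real t) = of_real (f t)" "\<forall>\<^sub>F t in nhds s. G (of_real t) = of_real (g t)"
    by (auto simp: real_analytic_at_def)
  then have "(\<lambda>z. F z + G z) analytic_on {complex_of_real s}"
    by (intro analytic_intros)
  moreover have "\<forall>\<^sub>F t in nhds s. F (of_real t) + G (of_real t) = of_real (f t + g t)"
    using ev by eventually_elim simp
  ultimately show ?thesis by (rule real_analytic_atI)
qed

lemma real_analytic_at_mult:
  assumes "real_analytic_at f s" "real_analytic_at g s"
  shows "real_analytic_at (\<lambda>t. f t * g t) s"
proof -
  from assms obtain F G where "F analytic_on {complex_of_real s}" "G analytic_on {complex_of_real s}"
    and ev: "\<forall>\<^sub>F t in nhds s. F (of_real t) = of_real (f t)" "\<forall>\<^sub>F t in nhds s. G (of_real t) = of_real (g t)"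
    by (auto simp: real_analytic_at_def)
  then have "(\<lambda>z. F z * G z) analytic_on {complex_of_real s}"
    by (intro analytic_intros)
  moreover have "\<forall>\<^sub>F t in nhds s. F (of_real t) * G (of_real t) = of_real (f t * g t)"
    using ev by eventually_elim simp
  ultimately show ?thesis by (rule real_analytic_atI)
qed

lemma real_analytic_at_diff:
  assumes "real_analytic_at f s" "real_analytic_at g s"
  shows "real_analytic_at (\<lambda>t. f t - g t) s"
  using real_analytic_at_add[OF assms(1) real_analytic_at_mult[OF real_analytic_at_const[of "-1"] assms(2)]]
  by simp

text \<open>The extension of the outer function is only known to be real on real points close to
  \<open>g s\<close>; continuity of the inner extension ensures that those points are reached.\<close>

lemma real_analytic_at_compose:
  assumes "real_analytic_at g s" "real_analytic_at f (g s)"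
  shows "real_analytic_at (\<lambda>t. f (g t)) s"
proof -
  from assms obtain F G where F: "F analytic_on {complex_of_real (g s)}"
    and G: "G analytic_on {complex_of_real s}"
    and evF: "\<forall>\<^sub>F t in nhds (g s). F (of_real t) = of_real (f t)"
    and evG: "\<forall>\<^sub>F t in nhds s. G (of_real t) = of_real (g t)"
    by (auto simp: real_analytic_at_def)
  have Gs: "G (of_real s) = of_real (g s)"
    using evG by (rule eventually_nhds_x_imp_x)
  have "(F \<circ> G) analytic_on {complex_of_real s}"
    by (rule analytic_on_compose[OF G]) (simp add: Gs F)
  moreover have "\<forall>\<^sub>F t in nhds s. (F \<circ> G) (of_real t) = of_real (f (g t))"
  proof -
    have "isCont (\<lambda>t. Re (G (of_real t))) s"
      by (intro isCont_Re isCont_o2[where f = of_real and g = G, OF _ analytic_at_imp_isCont[OF G]]) auto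
    then have "((\<lambda>t. Re (G (of_real t))) \<longlongrightarrow> Re (G (of_real s))) (nhds s)"
      unfolding isCont_def by (rule iffD1[OF tendsto_at_iff_tendsto_nhds])
    then have "((\<lambda>t. Re (G (of_real t))) \<longlongrightarrow> g s) (nhds s)"
      by (simp add: Gs)
    then have "\<forall>\<^sub>F t in nhds s. F (of_real (Re (G (of_real t)))) = of_real (f (Re (G (of_real t))))"
      using evF by (auto simp: filterlim_iff)
    then show ?thesis
      using evG by eventually_elim simp
  qed
  ultimately show ?thesis by (rule real_analytic_atI)
qed

lemma real_analytic_at_inverse:
  assumes "s \<noteq> 0"
  shows "real_analytic_at inverse s"
  by (rule real_analytic_atI[of inverse]) (use assms in \<open>auto intro!: analytic_intros\<close>)

lemma real_analytic_at_divide: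
  assumes "real_analytic_at f s" "real_analytic_at g s" "g s \<noteq> 0"
  shows "real_analytic_at (\<lambda>t. f t / g t) s"
  unfolding divide_inverse
  by (intro real_analytic_at_mult assms real_analytic_at_compose[OF assms(2)] real_analytic_at_inverse)

lemma real_analytic_at_sqrt:
  assumes "real_analytic_at f s" "f s > 0"
  shows "real_analytic_at (\<lambda>t. sqrt (f t)) s"
proof (rule real_analytic_at_compose[OF assms(1)], rule real_analytic_atI)
  show "csqrt analytic_on {complex_of_real (f s)}"
    by (rule analytic_on_subset[OF analytic_on_csqrt]) (use assms(2) in \<open>auto simp: complex_nonpos_Reals_iff\<close>)
  have "\<forall>\<^sub>F x in nhds (f s). x \<in> {0<..}"
    using assms(2) by (intro eventually_nhds_in_open) auto
  then show "\<forall>\<^sub>F x in nhds (f s). csqrt (of_real x) = of_real (sqrt x)"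
    by eventually_elim (simp add: csqrt_of_real_nonneg)
qed

lemma real_analytic_at_power:
  assumes "real_analytic_at f s"
  shows "real_analytic_at (\<lambda>t. f t ^ n) s"
  by (induction n) (simp_all add: real_analytic_at_const real_analytic_at_mult assms)

lemma real_analytic_at_sum:
  assumes "\<And>i. i \<in> A \<Longrightarrow> real_analytic_at (f i) s"
  shows "real_analytic_at (\<lambda>t. \<Sum>i\<in>A. f i t) s"
  using assms by (induction A rule: infinite_finite_induct)
    (auto simp: real_analytic_at_const intro: real_analytic_at_add)

text \<open>The complex derivative is a limit of difference quotients along the real axis, where the
  extension is real; hence it is real there and restricts to the real derivative.\<close>

lemma real_analytic_at_derivative:
  assumes "real_analytic_at f s"
  obtains f' where "real_analytic_at f' s" "\<forall>\<^sub>F t in nhds s. (f has_real_derivative f' t) (at t)"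
proof -
  obtain r F where r: "r > 0" and F: "F holomorphic_on ball (complex_of_real s) r"
    and eq: "\<And>t. \<bar>t - s\<bar> < r \<Longrightarrow> F (of_real t) = of_real (f t)"
    by (rule real_analytic_atE[OF assms]) blast
  have D: "((\<lambda>x. complex_of_real (f x)) has_vector_derivative deriv F (of_real t)) (at t)"
    if t: "t \<in> ball s r" for t
  proof -
    have "(F has_field_derivative deriv F (of_real t)) (at (of_real t))"
      by (rule holomorphic_derivI[OF F]) (use t in \<open>auto simp flip: of_real_diff simp: dist_norm\<close>)
    then have "((\<lambda>x. F (of_real x)) has_vector_derivative deriv F (of_real t)) (at t)"
      by (rule has_vector_derivative_real_field)
    then show ?thesis
      by (rule has_vector_derivative_transform_within_open[of _ _ _ "ball s r"])
        (use t eq in \<open>auto simp: dist_real_def abs_minus_commute\<close>)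
  qed
  have re: "(f has_real_derivative Re (deriv F (of_real t))) (at t)"
    and im: "Im (deriv F (of_real t)) = 0" if t: "t \<in> ball s r" for t
  proof -
    show "(f has_real_derivative Re (deriv F (of_real t))) (at t)"
      using bounded_linear.has_vector_derivative[OF bounded_linear_Re D[OF t]]
      by (simp add: has_real_derivative_iff_has_vector_derivative)
    have "((\<lambda>x. 0) has_vector_derivative Im (deriv F (of_real t))) (at t)"
      using bounded_linear.has_vector_derivative[OF bounded_linear_Im D[OF t]] by simp
    then show "Im (deriv F (of_real t)) = 0"
      using vector_derivative_unique_at has_vector_derivative_const by blast
  qed
  have ev: "\<forall>\<^sub>F t in nhds s. t \<in> ball s r"
    using r by (intro eventually_nhds_in_open) auto
  show ?thesis
  proof
    show "real_analytic_at (\<lambda>t. Re (deriv F (of_real t))) s"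
    proof (rule real_analytic_atI)
      show "deriv F analytic_on {complex_of_real s}"
        using F r by (intro analytic_deriv holomorphic_on_imp_analytic_at[OF F]) auto
      show "\<forall>\<^sub>F t in nhds s. deriv F (of_real t) = of_real (Re (deriv F (of_real t)))"
        using ev by eventually_elim (simp add: complex_eq_iff im)
    qed
    show "\<forall>\<^sub>F t in nhds s. (f has_real_derivative Re (deriv F (of_real t))) (at t)"
      using ev by eventually_elim (rule re)
  qed
qed

lemma real_analytic_at_imp_isCont:
  assumes "real_analytic_at f s"
  shows "isCont f s"
proof -
  obtain f' where "\<forall>\<^sub>F t in nhds s. (f has_real_derivative f' t) (at t)"
    by (rule real_analytic_at_derivative[OF assms])
  then show ?thesis
    using eventually_nhds_x_imp_x DERIV_isCont by fastforce
qed

text \<open>All equations that are known only where the curvatures do not vanish are extended by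
  this principle to the remaining, isolated points.\<close>

lemma isCont_eq_zeroI:
  fixes f :: "real \<Rightarrow> 'a::real_normed_vector"
  assumes "isCont f s" "\<forall>\<^sub>F t in at s. f t = 0"
  shows "f s = 0"
proof -
  have "(f \<longlongrightarrow> 0) (at s)"
    using assms(2) by (rule tendsto_eventually)
  moreover have "(f \<longlongrightarrow> f s) (at s)"
    using assms(1) by (simp add: isCont_def)
  ultimately show ?thesis
    using tendsto_unique trivial_limit_at by blast
qed

text \<open>The factorization comes from the order of the complex zero. The cofactor is real on the
  real axis: away from \<open>s\<close> it is a quotient of real numbers, and at \<open>s\<close> by continuity.\<close>

lemma real_analytic_at_factor:
  assumes "real_analytic_at f s" "\<not> (\<forall>\<^sub>F t in nhds s. f t = 0)"
  obtains g k where "real_analytic_at g s" "g s \<noteq> 0" "\<forall>\<^sub>F t in nhds s. f t = (t - s) ^ k * g t"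
proof -
  let ?z = "complex_of_real s"
  obtain r F where r: "r > 0" and F: "F holomorphic_on ball ?z r"
    and eq: "\<And>t. \<bar>t - s\<bar> < r \<Longrightarrow> F (of_real t) = of_real (f t)"
    by (rule real_analytic_atE[OF assms(1)]) blast
  have "\<exists>t. \<bar>t - s\<bar> < r \<and> f t \<noteq> 0"
    using assms(2) r by (auto simp: eventually_nhds_metric dist_real_def)
  then obtain t0 where t0: "\<bar>t0 - s\<bar> < r" "f t0 \<noteq> 0" by blast
  then have "\<exists>w\<in>ball ?z r. F w \<noteq> 0"
    using eq[OF t0(1)]
    by (intro bexI[of _ "of_real t0"]) (auto simp flip: of_real_diff simp: dist_norm abs_minus_commute)
  moreover have "?z \<in> ball ?z r" using r by simp
  ultimately have "\<exists>d>0. cball ?z d \<subseteq> ball ?z r \<and> zor_poly F ?z holomorphic_on cball ?z d \<and>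
      (\<forall>w\<in>cball ?z d. F w = zor_poly F ?z w * (w - ?z) ^ nat (zorder F ?z) \<and> zor_poly F ?z w \<noteq> 0)"
    using zorder_exist_zero[OF F open_ball connected_ball] by blast
  then obtain G d k where d: "d > 0" "cball ?z d \<subseteq> ball ?z r" and G: "G holomorphic_on cball ?z d"
    and fac: "\<And>w. w \<in> cball ?z d \<Longrightarrow> F w = G w * (w - ?z) ^ k \<and> G w \<noteq> 0"
    by blast
  have Gan: "G analytic_on {?z}"
    using d(1) by (intro holomorphic_on_imp_analytic_at[OF holomorphic_on_subset[OF G ball_subset_cball]]) auto
  have mem: "complex_of_real t \<in> cball ?z d" if "t \<in> ball s d" for t
    using that by (auto simp flip: of_real_diff simp: dist_norm)
  have feq: "of_real (f t) = G (of_real t) * of_real ((t - s) ^ k)" if t: "t \<in> ball s d" for t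
  proof -
    have "\<bar>t - s\<bar> < r"
      using subsetD[OF d(2) mem[OF t]] by (auto simp flip: of_real_diff simp: dist_norm abs_minus_commute)
    then show ?thesis
      using eq[of t] fac[OF mem[OF t]] by simp
  qed
  have im: "Im (G (of_real t)) = 0" if t: "t \<in> ball s d" "t \<noteq> s" for t
  proof -
    have "Im (G (of_real t)) * (t - s) ^ k = 0"
      using arg_cong[OF feq[OF t(1)], of Im] by simp
    then show ?thesis using t(2) by simp
  qed
  have ev: "\<forall>\<^sub>F t in nhds s. t \<in> ball s d"
    using d by (intro eventually_nhds_in_open) auto
  have im0: "Im (G (of_real s)) = 0"
  proof (rule isCont_eq_zeroI[where f = "\<lambda>t. Im (G (complex_of_real t))"])
    show "isCont (\<lambda>t. Im (G (complex_of_real t))) s"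
      by (intro isCont_Im isCont_o2[where f = of_real and g = G, OF _ analytic_at_imp_isCont[OF Gan]]) auto
    show "\<forall>\<^sub>F t in at s. Im (G (complex_of_real t)) = 0"
      using ev unfolding eventually_at_filter by eventually_elim (use im in auto)
  qed
  have real: "G (of_real t) = of_real (Re (G (of_real t)))" if "t \<in> ball s d" for t
    using im[OF that] im0 by (cases "t = s") (auto simp: complex_eq_iff)
  show ?thesis
  proof (rule that)
    show "real_analytic_at (\<lambda>t. Re (G (of_real t))) s"
      by (rule real_analytic_atI[OF Gan]) (use ev real in \<open>auto elim!: eventually_mono\<close>)
    have s: "s \<in> ball s d" using d by simp
    show "Re (G (of_real s)) \<noteq> 0"
      using fac[OF mem[OF s]] real[OF s] by auto
    show "\<forall>\<^sub>F t in nhds s. f t = (t - s) ^ k * Re (G (of_real t))"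
      using ev
    proof eventually_elim
      case (elim t)
      show ?case using arg_cong[OF feq[OF elim], of Re] by (simp add: mult.commute)
    qed
  qed
qed

lemma real_analytic_at_isolated_zeros:
  assumes "real_analytic_at f s" "\<not> (\<forall>\<^sub>F t in nhds s. f t = 0)"
  shows "\<forall>\<^sub>F t in at s. f t \<noteq> 0"
proof -
  obtain g k where g: "real_analytic_at g s" "g s \<noteq> 0" and eq: "\<forall>\<^sub>F t in nhds s. f t = (t - s) ^ k * g t"
    by (rule real_analytic_at_factor[OF assms])
  have "\<forall>\<^sub>F t in at s. g t \<noteq> 0"
    using real_analytic_at_imp_isCont[OF g(1)] g(2) unfolding isCont_def by (rule tendsto_imp_eventually_ne)
  moreover have "\<forall>\<^sub>F t in at s. t \<noteq> s"
    by (auto simp: eventually_at_filter)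
  moreover have "\<forall>\<^sub>F t in at s. f t = (t - s) ^ k * g t"
    using eq unfolding eventually_at_filter by eventually_elim simp
  ultimately show ?thesis by eventually_elim auto
qed

text \<open>By the isolation of zeros, the points near which \<open>f\<close> vanishes identically and the other points
  form two open sets. They cannot both meet the connected set \<open>J\<close>.\<close>

lemma real_analytic_identity:
  assumes "open J" "connected J" "\<And>s. s \<in> J \<Longrightarrow> real_analytic_at f s" "s0 \<in> J" "f s0 \<noteq> 0"
    and s: "s \<in> J"
  shows "\<forall>\<^sub>F t in at s. f t \<noteq> 0"
proof -
  define A where "A = {x \<in> J. \<forall>\<^sub>F t in nhds x. f t = 0}"
  define B where "B = {x \<in> J. \<not> (\<forall>\<^sub>F t in nhds x. f t = 0)}"
  have "open A"
  proof (subst open_subopen, safe)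
    fix x assume x: "x \<in> A"
    then obtain U where U: "open U" "x \<in> U" "\<forall>t\<in>U. f t = 0"
      by (auto simp: A_def eventually_nhds)
    then have "U \<inter> J \<subseteq> A"
      by (auto simp: A_def eventually_nhds)
    then show "\<exists>T. open T \<and> x \<in> T \<and> T \<subseteq> A"
      using U x assms(1) by (intro exI[of _ "U \<inter> J"]) (auto simp: A_def)
  qed
  moreover have "open B"
  proof (subst open_subopen, safe)
    fix x assume x: "x \<in> B"
    then have "\<forall>\<^sub>F t in at x. f t \<noteq> 0"
      using assms(3) by (intro real_analytic_at_isolated_zeros) (auto simp: B_def)
    then obtain U where U: "open U" "x \<in> U" "\<And>t. t \<in> U \<Longrightarrow> t \<noteq> x \<Longrightarrow> f t \<noteq> 0"
      by (auto simp: eventually_at_topological)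
    have "y \<in> B" if y: "y \<in> U \<inter> J" for y
    proof (cases "y = x")
      case False
      then have "f y \<noteq> 0" using U(3) y by blast
      then show ?thesis
        using y eventually_nhds_x_imp_x by (fastforce simp: B_def)
    qed (use x in simp)
    then show "\<exists>T. open T \<and> x \<in> T \<and> T \<subseteq> B"
      using U x assms(1) by (intro exI[of _ "U \<inter> J"]) (auto simp: B_def)
  qed
  moreover have "s0 \<in> B"
    using assms(4,5) eventually_nhds_x_imp_x by (fastforce simp: B_def)
  moreover have "J \<subseteq> A \<union> B" "A \<inter> B \<inter> J = {}"
    by (auto simp: A_def B_def)
  ultimately have "A \<inter> J = {}"
    using connectedD[OF assms(2), of A B] assms(4) by blast
  then have "\<not> (\<forall>\<^sub>F t in nhds s. f t = 0)"
    using s by (auto simp: A_def)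
  then show ?thesis
    using assms(3) s by (intro real_analytic_at_isolated_zeros) auto
qed

text \<open>The bound forces the order of the zero of \<open>f\<close> to be at least that of \<open>g\<close>; otherwise the
  cofactor of \<open>f\<close> would tend to zero at \<open>s\<close>.\<close>

lemma real_analytic_at_removable_quotient:
  assumes f: "real_analytic_at f s" and g: "real_analytic_at g s" "\<not> (\<forall>\<^sub>F t in nhds s. g t = 0)"
    and le: "\<forall>\<^sub>F t in nhds s. \<bar>f t\<bar> \<le> \<bar>g t\<bar>"
  obtains q where "real_analytic_at q s" "\<forall>\<^sub>F t in nhds s. f t = g t * q t"
proof (cases "\<forall>\<^sub>F t in nhds s. f t = 0")
  case True
  show ?thesis
    by (rule that[of "\<lambda>_. 0"]) (use True in \<open>auto simp: real_analytic_at_const\<close>)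
next
  case False
  obtain F k where F: "real_analytic_at F s" "F s \<noteq> 0" and feq: "\<forall>\<^sub>F t in nhds s. f t = (t - s) ^ k * F t"
    by (rule real_analytic_at_factor[OF f False])
  obtain G m where G: "real_analytic_at G s" "G s \<noteq> 0" and geq: "\<forall>\<^sub>F t in nhds s. g t = (t - s) ^ m * G t"
    by (rule real_analytic_at_factor[OF g])
  have "m \<le> k"
  proof (rule ccontr)
    assume "\<not> m \<le> k"
    then obtain j where j: "m = k + Suc j"
      by (metis add_Suc_right less_imp_Suc_add not_le)
    \<comment> \<open>cancelling \<open>(t - s) ^ k\<close> leaves a continuous function that is nonnegative at all nearby points other than \<open>s\<close> but negative at \<open>s\<close>\<close>
    let ?d = "\<lambda>t. \<bar>(t - s) ^ Suc j * G t\<bar> - \<bar>F t\<bar>"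
    have ge: "\<forall>\<^sub>F t in at s. 0 \<le> ?d t"
      using feq geq le unfolding eventually_at_filter
    proof eventually_elim
      case (elim t)
      show ?case
      proof (intro impI)
        assume t: "t \<noteq> s"
        have "\<bar>(t - s) ^ k\<bar> * \<bar>F t\<bar> \<le> \<bar>(t - s) ^ k\<bar> * \<bar>(t - s) ^ Suc j * G t\<bar>"
          using elim by (simp add: j power_add abs_mult mult_ac)
        then show "0 \<le> ?d t"
          using t by (simp add: mult_le_cancel_left)
      qed
    qed
    have "isCont ?d s"
      by (intro continuous_intros real_analytic_at_imp_isCont F G)
    then have "(?d \<longlongrightarrow> ?d s) (at s)" by (simp add: isCont_def)
    then have "0 \<le> ?d s"
      using ge by (rule tendsto_lowerbound) simp
    then show False using F(2) by simp
  qed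
  define q where "q = (\<lambda>t. (t - s) ^ (k - m) * F t / G t)"
  have "real_analytic_at q s"
    unfolding q_def
    by (intro real_analytic_at_divide real_analytic_at_mult real_analytic_at_power real_analytic_at_diff
        real_analytic_at_ident real_analytic_at_const F G)
  moreover have "\<forall>\<^sub>F t in nhds s. G t \<noteq> 0"
    using real_analytic_at_imp_isCont[OF G(1)] G(2)
    unfolding isCont_def tendsto_at_iff_tendsto_nhds by (rule tendsto_imp_eventually_ne)
  then have "\<forall>\<^sub>F t in nhds s. f t = g t * q t"
    using feq geq
  proof eventually_elim
    case (elim t)
    have "(t - s) ^ k = (t - s) ^ m * (t - s) ^ (k - m)"
      using \<open>m \<le> k\<close> by (simp flip: power_add)
    then show ?case using elim by (simp add: q_def)
  qed
  ultimately show ?thesis by (rule that)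
qed

lemma antiderivative_on_open_interval:
  fixes g :: "real \<Rightarrow> real"
  assumes "open J" "is_interval J" "continuous_on J g"
  obtains G where "\<And>s. s \<in> J \<Longrightarrow> (G has_real_derivative g s) (at s)"
proof (cases "J = {}")
  case False
  then obtain c where c: "c \<in> J" by blast
  have "((\<lambda>u. LBINT y=c..u. g y) has_real_derivative g s) (at s)" if s: "s \<in> J" for s
  proof -
    obtain e where e: "e > 0" "cball c e \<subseteq> J"
      using assms(1) c open_contains_cball by blast
    obtain d where d: "d > 0" "cball s d \<subseteq> J"
      using assms(1) s open_contains_cball by blast
    \<comment> \<open>an interval containing both \<open>c\<close> and \<open>s\<close> in its interior, so that the derivative is two-sided\<close>
    define x y where "x = min (c - e) (s - d)" and "y = max (c + e) (s + d)"
    have "c - e \<in> cball c e" "c + e \<in> cball c e" "s - d \<in> cball s d" "s + d \<in> cball s d"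
      using e(1) d(1) by (simp_all add: dist_real_def)
    then have "x \<in> J" "y \<in> J"
      using e(2) d(2) by (auto simp: x_def y_def min_def max_def)
    then have sub: "{x..y} \<subseteq> J"
      using mem_is_interval_1_I[OF assms(2)] by (meson atLeastAtMost_iff subsetI)
    have "((\<lambda>u. LBINT y=c..u. g y) has_vector_derivative g s) (at s within {x..y})"
      using e d by (intro interval_integral_FTC2 continuous_on_subset[OF assms(3) sub])
        (auto simp: x_def y_def)
    moreover have "at s within {x..y} = at s"
      using e d by (intro at_within_interior) (auto simp: x_def y_def min_def max_def)
    ultimately show ?thesis
      by (simp add: has_real_derivative_iff_has_vector_derivative)
  qed
  then show ?thesis by (rule that)
qed (use that in auto)

text \<open>A holomorphic primitive of the extension of \<open>g\<close> differs from \<open>G\<close> on the real axis by a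
  constant, because the two have the same derivative there.\<close>

lemma real_analytic_at_antiderivative:
  assumes "real_analytic_at g s" and G: "\<forall>\<^sub>F x in nhds s. (G has_real_derivative g x) (at x)"
  shows "real_analytic_at G s"
proof -
  obtain r F where r: "r > 0" and F: "F holomorphic_on ball (complex_of_real s) r"
    and eq: "\<And>t. \<bar>t - s\<bar> < r \<Longrightarrow> F (of_real t) = of_real (g t)"
    by (rule real_analytic_atE[OF assms(1)]) blast
  obtain P where P: "\<And>z. z \<in> ball (complex_of_real s) r \<Longrightarrow>
      (P has_field_derivative F z) (at z within ball (of_real s) r)"
    using holomorphic_convex_primitive'[OF convex_ball open_ball F] by blast
  have P': "(P has_field_derivative F z) (at z)" if "z \<in> ball (complex_of_real s) r" for z
    using P[OF that] that by (simp add: at_within_open[OF _ open_ball])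
  obtain d where d: "d > 0" "\<And>x. dist x s < d \<Longrightarrow> (G has_real_derivative g x) (at x)"
    using G by (auto simp: eventually_nhds_metric)
  let ?U = "ball s (min r d)"
  have D: "((\<lambda>x. P (of_real x) - of_real (G x)) has_vector_derivative 0) (at x within ?U)"
    if x: "x \<in> ?U" for x
  proof -
    have xr: "\<bar>x - s\<bar> < r" and xd: "dist x s < d"
      using x by (auto simp: dist_real_def abs_minus_commute)
    have "((\<lambda>x. P (of_real x)) has_vector_derivative of_real (g x)) (at x)"
      using has_vector_derivative_real_field[OF P'[of "of_real x"]] xr
      by (simp add: eq dist_norm abs_minus_commute flip: of_real_diff)
    moreover have "((\<lambda>x. of_real (G x)) has_vector_derivative complex_of_real (g x)) (at x)"
      using d(2)[OF xd] by (intro has_vector_derivative_of_real)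
         (simp add: has_real_derivative_iff_has_vector_derivative)
    ultimately have "((\<lambda>x. P (of_real x) - of_real (G x)) has_vector_derivative
        of_real (g x) - of_real (g x)) (at x)"
      by (rule has_vector_derivative_diff)
    then show ?thesis
      by (simp add: has_vector_derivative_at_within)
  qed
  obtain C where C: "\<And>x. x \<in> ?U \<Longrightarrow> P (of_real x) - of_real (G x) = C"
    by (rule has_vector_derivative_zero_constant[OF convex_ball, OF D]) auto
  show ?thesis
  proof (rule real_analytic_atI)
    have "P holomorphic_on ball (of_real s) r"
      using P' holomorphic_on_open[OF open_ball] by blast
    then show "(\<lambda>z. P z - C) analytic_on {complex_of_real s}"
      using r by (intro analytic_intros holomorphic_on_imp_analytic_at[of P "ball (of_real s) r"]) auto
    have "\<forall>\<^sub>F x in nhds s. x \<in> ?U"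
      using r d by (intro eventually_nhds_in_open) auto
    then show "\<forall>\<^sub>F x in nhds s. P (of_real x) - C = of_real (G x)"
      by eventually_elim (use C in force)
  qed
qed

text \<open>The extension of \<open>f\<close> has a local holomorphic inverse. Continuity of \<open>g\<close> keeps its values in
  the disc on which that inverse is defined, so the two agree on the real axis.\<close>

lemma real_analytic_at_inverse_function:
  assumes f: "real_analytic_at f s" "(f has_real_derivative d) (at s)" "d \<noteq> 0"
    and g: "isCont g (f s)" "g (f s) = s" "\<forall>\<^sub>F y in nhds (f s). f (g y) = y"
  shows "real_analytic_at g (f s)"
proof -
  obtain r F where r: "r > 0" and F: "F holomorphic_on ball (complex_of_real s) r"
    and eq: "\<And>t. \<bar>t - s\<bar> < r \<Longrightarrow> F (of_real t) = of_real (f t)"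
    by (rule real_analytic_atE[OF f(1)]) blast
  have s: "complex_of_real s \<in> ball (of_real s) r" using r by simp
  have "((\<lambda>x. F (of_real x)) has_vector_derivative deriv F (of_real s)) (at s)"
    by (intro has_vector_derivative_real_field holomorphic_derivI[OF F open_ball s])
  then have "((\<lambda>x. of_real (f x)) has_vector_derivative deriv F (of_real s)) (at s)"
    by (rule has_vector_derivative_transform_within_open[of _ _ _ "ball s r"])
      (use r eq in \<open>auto simp: dist_real_def abs_minus_commute\<close>)
  moreover have "((\<lambda>x. of_real (f x)) has_vector_derivative complex_of_real d) (at s)"
    using f(2) by (intro has_vector_derivative_of_real)
       (simp add: has_real_derivative_iff_has_vector_derivative)
  ultimately have "deriv F (of_real s) = of_real d"
    by (rule vector_derivative_unique_at)
  with f(3) have "deriv F (of_real s) \<noteq> 0" by simp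
  from has_complex_derivative_locally_invertible[OF F s open_ball this]
  obtain e where e: "e > 0" "ball (of_real s) e \<subseteq> ball (complex_of_real s) r"
    "open (F ` ball (of_real s) e)" "inj_on F (ball (of_real s) e)" by blast
  obtain G where G: "G holomorphic_on F ` ball (of_real s) e"
    "\<And>z. z \<in> ball (of_real s) e \<Longrightarrow> G (F z) = z"
    using holomorphic_has_inverse[OF holomorphic_on_subset[OF F e(2)] open_ball e(4)] by metis
  have Fs: "F (of_real s) = of_real (f s)" using eq[of s] r by simp
  show ?thesis
  proof (rule real_analytic_atI)
    show "G analytic_on {complex_of_real (f s)}"
      using e(1,3) by (intro holomorphic_on_imp_analytic_at[OF G(1)]) (auto simp flip: Fs)
    have "(g \<longlongrightarrow> s) (nhds (f s))"
      using iffD1[OF tendsto_at_iff_tendsto_nhds g(1)[unfolded isCont_def]] g(2) by simp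
    then have "\<forall>\<^sub>F y in nhds (f s). g y \<in> ball s e"
      using e(1) by (intro topological_tendstoD) auto
    then show "\<forall>\<^sub>F y in nhds (f s). G (of_real y) = of_real (g y)"
      using g(3)
    proof eventually_elim
      case (elim y)
      have mem: "complex_of_real (g y) \<in> ball (of_real s) e"
        using elim(1) by (auto simp: dist_norm simp flip: of_real_diff)
      then have "\<bar>g y - s\<bar> < r"
        using e(2) by (fastforce simp: dist_norm abs_minus_commute simp flip: of_real_diff)
      then have "F (of_real (g y)) = of_real y" using eq elim(2) by simp
      then show ?case using G(2)[OF mem] by simp
    qed
  qed
qed

text \<open>A real power series converges absolutely on the complex disc of the same radius, which gives
  the extension. Conversely the real parts of the complex Taylor coefficients serve as
  real coefficients.\<close>

lemma power_series_iff_real_analytic_at: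
  fixes f :: "real \<Rightarrow> real"
  shows "(\<exists>r>0. \<exists>c. \<forall>t. \<bar>t - s\<bar> < r \<longrightarrow> (\<lambda>n. (t - s) ^ n * c n) sums f t) \<longleftrightarrow> real_analytic_at f s"
proof
  assume "\<exists>r>0. \<exists>c. \<forall>t. \<bar>t - s\<bar> < r \<longrightarrow> (\<lambda>n. (t - s) ^ n * c n) sums f t"
  then obtain r c where r: "r > 0" and c: "\<And>t. \<bar>t - s\<bar> < r \<Longrightarrow> (\<lambda>n. (t - s) ^ n * c n) sums f t"
    by blast
  define F where "F z = (\<Sum>n. complex_of_real (c n) * (z - of_real s) ^ n)" for z
  have real_sums: "(\<lambda>n. complex_of_real (c n) * (of_real t - of_real s) ^ n) sums of_real (f t)"
    if "\<bar>t - s\<bar> < r" for t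
    using sums_of_real[OF c[OF that], where 'a = complex] by (simp add: mult.commute)
  have "F holomorphic_on ball (of_real s) r"
  proof (rule power_series_holomorphic)
    fix z assume z: "z \<in> ball (complex_of_real s) r"
    then obtain d where d: "norm (z - of_real s) < d" "d < r"
      using dense[of "norm (z - of_real s)" r] by (auto simp: dist_norm norm_minus_commute)
    have "0 \<le> norm (z - of_real s)" by simp
    then have "d > 0" using d(1) by linarith
    have "summable (\<lambda>n. complex_of_real (c n) * (of_real (s + d) - of_real s) ^ n)"
      using real_sums[of "s + d"] d \<open>d > 0\<close> sums_summable by auto
    then have "summable (\<lambda>n. complex_of_real (c n) * (z - of_real s) ^ n)"
      by (rule powser_inside) (use d \<open>d > 0\<close> in auto)
    then show "(\<lambda>n. complex_of_real (c n) * (z - of_real s) ^ n) sums F z"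
      unfolding F_def by (rule summable_sums)
  qed
  then have "F analytic_on {complex_of_real s}"
    using r by (intro holomorphic_on_imp_analytic_at[of F "ball (of_real s) r"]) auto
  moreover have "\<forall>\<^sub>F t in nhds s. t \<in> ball s r"
    using r by (intro eventually_nhds_in_open) auto
  then have "\<forall>\<^sub>F t in nhds s. F (of_real t) = of_real (f t)"
    by eventually_elim
      (auto simp: F_def dist_real_def abs_minus_commute intro!: sums_unique[symmetric] real_sums)
  ultimately show "real_analytic_at f s" by (rule real_analytic_atI)
next
  assume "real_analytic_at f s"
  then obtain r F where r: "r > 0" and F: "F holomorphic_on ball (complex_of_real s) r"
    and eq: "\<And>t. \<bar>t - s\<bar> < r \<Longrightarrow> F (of_real t) = of_real (f t)"
    by (rule real_analytic_atE) blast
  define c where "c n = Re ((deriv ^^ n) F (of_real s) / fact n)" for n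
  have "(\<lambda>n. (t - s) ^ n * c n) sums f t" if t: "\<bar>t - s\<bar> < r" for t
  proof -
    have "of_real t \<in> ball (complex_of_real s) r"
      using t by (auto simp flip: of_real_diff simp: dist_norm abs_minus_commute)
    from sums_Re[OF holomorphic_power_series[OF F this]]
    have "(\<lambda>n. Re ((deriv ^^ n) F (of_real s) / fact n * of_real ((t - s) ^ n))) sums f t"
      by (simp add: eq[OF t])
    moreover have "Re ((deriv ^^ n) F (of_real s) / fact n * of_real ((t - s) ^ n)) = (t - s) ^ n * c n" for n
      unfolding c_def by (simp only: Re_complex_of_real Im_complex_of_real times_complex.simps mult_zero_right diff_zero mult.commute)
    ultimately show ?thesis by simp
  qed
  then show "\<exists>r>0. \<exists>c. \<forall>t. \<bar>t - s\<bar> < r \<longrightarrow> (\<lambda>n. (t - s) ^ n * c n) sums f t"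
    using r by blast
qed

section \<open>Analytic curves\<close>

definition curve_analytic_at :: "(real \<Rightarrow> real ^ 'n::finite) \<Rightarrow> real \<Rightarrow> bool" where
  "curve_analytic_at \<gamma> s \<longleftrightarrow> (\<forall>i. real_analytic_at (\<lambda>t. \<gamma> t $ i) s)"

lemma real_analytic_on_real_iff:
  fixes f :: "real \<Rightarrow> real"
  shows "real_analytic_on I f \<longleftrightarrow> (\<forall>s\<in>I. real_analytic_at f s)"
  unfolding real_analytic_on_def real_scaleR_def power_series_iff_real_analytic_at ..

lemma real_analytic_on_curve_iff:
  fixes \<gamma> :: "real \<Rightarrow> real ^ 'n::finite"
  shows "real_analytic_on I \<gamma> \<longleftrightarrow> (\<forall>s\<in>I. curve_analytic_at \<gamma> s)"
proof -
  have "(\<exists>r>0. \<exists>c. \<forall>t. \<bar>t - s\<bar> < r \<longrightarrow> (\<lambda>n. (t - s) ^ n *\<^sub>R c n) sums \<gamma> t) \<longleftrightarrow> curve_analytic_at \<gamma> s" for s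
  proof
    assume "\<exists>r>0. \<exists>c. \<forall>t. \<bar>t - s\<bar> < r \<longrightarrow> (\<lambda>n. (t - s) ^ n *\<^sub>R c n) sums \<gamma> t"
    then obtain r c where r: "r > 0" and c: "\<And>t. \<bar>t - s\<bar> < r \<Longrightarrow> (\<lambda>n. (t - s) ^ n *\<^sub>R c n) sums \<gamma> t"
      by blast
    have "(\<lambda>n. (t - s) ^ n * c n $ i) sums (\<gamma> t $ i)" if "\<bar>t - s\<bar> < r" for t i
      using bounded_linear.sums[OF bounded_linear_vec_nth c[OF that]] by simp
    then have "real_analytic_at (\<lambda>t. \<gamma> t $ i) s" for i
      using r by (intro iffD1[OF power_series_iff_real_analytic_at] exI[of _ r] conjI exI[of _ "\<lambda>n. c n $ i"]) auto
    then show "curve_analytic_at \<gamma> s"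
      by (simp add: curve_analytic_at_def)
  next
    assume "curve_analytic_at \<gamma> s"
    then have "\<forall>i. \<exists>r>0. \<exists>c. \<forall>t. \<bar>t - s\<bar> < r \<longrightarrow> (\<lambda>n. (t - s) ^ n * c n) sums (\<gamma> t $ i)"
      unfolding curve_analytic_at_def power_series_iff_real_analytic_at .
    from choice[OF this] obtain r where r: "\<forall>i. r i > 0 \<and>
        (\<exists>c. \<forall>t. \<bar>t - s\<bar> < r i \<longrightarrow> (\<lambda>n. (t - s) ^ n * c n) sums (\<gamma> t $ i))" ..
    then have "\<forall>i. \<exists>c. \<forall>t. \<bar>t - s\<bar> < r i \<longrightarrow> (\<lambda>n. (t - s) ^ n * c n) sums (\<gamma> t $ i)"
      by simp
    from choice[OF this] obtain c
      where c: "\<forall>i t. \<bar>t - s\<bar> < r i \<longrightarrow> (\<lambda>n. (t - s) ^ n * c i n) sums (\<gamma> t $ i)" ..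
    have "(\<lambda>n. (t - s) ^ n *\<^sub>R (\<chi> i. c i n)) sums \<gamma> t" if "\<bar>t - s\<bar> < Min (range r)" for t
      unfolding sums_def
    proof (rule vec_tendstoI)
      fix i
      have "\<bar>t - s\<bar> < r i" using that by simp
      then have "(\<lambda>n. (t - s) ^ n * c i n) sums (\<gamma> t $ i)"
        using c by simp
      then show "(\<lambda>m. (\<Sum>n<m. (t - s) ^ n *\<^sub>R (\<chi> i. c i n)) $ i) \<longlonglongrightarrow> \<gamma> t $ i"
        by (simp add: sums_def)
    qed
    moreover have "Min (range r) > 0" using r by simp
    ultimately show "\<exists>r>0. \<exists>c. \<forall>t. \<bar>t - s\<bar> < r \<longrightarrow> (\<lambda>n. (t - s) ^ n *\<^sub>R c n) sums \<gamma> t"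
      by (intro exI[of _ "Min (range r)"] exI[of _ "\<lambda>n. \<chi> i. c i n"] conjI allI impI)
  qed
  then show ?thesis by (simp add: real_analytic_on_def)
qed

text \<open>The curve is the finite sum of its components times the standard basis vectors, so the
  derivative is computed summand by summand.\<close>

lemma has_vector_derivative_vecI:
  fixes \<gamma> :: "real \<Rightarrow> real ^ 'n::finite"
  assumes "\<And>i. ((\<lambda>t. \<gamma> t $ i) has_real_derivative d $ i) (at s)"
  shows "(\<gamma> has_vector_derivative d) (at s)"
proof -
  have "((\<lambda>t. \<Sum>i\<in>UNIV. \<gamma> t $ i *\<^sub>R axis i (1::real)) has_vector_derivative
      (\<Sum>i\<in>UNIV. d $ i *\<^sub>R axis i 1)) (at s)"
    by (intro has_vector_derivative_sum)
      (use has_vector_derivative_scaleR[OF assms has_vector_derivative_const] in simp)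
  then show ?thesis
    by (simp add: basis_expansion flip: scalar_mult_eq_scaleR)
qed

lemma curve_analytic_at_cong:
  assumes "curve_analytic_at \<gamma> s" "\<forall>\<^sub>F t in nhds s. \<delta> t = \<gamma> t"
  shows "curve_analytic_at \<delta> s"
  unfolding curve_analytic_at_def
proof
  fix i
  have "\<forall>\<^sub>F t in nhds s. \<delta> t $ i = \<gamma> t $ i"
    using assms(2) by eventually_elim simp
  then show "real_analytic_at (\<lambda>t. \<delta> t $ i) s"
    using assms(1) by (auto simp: curve_analytic_at_def intro: real_analytic_at_cong[of "\<lambda>t. \<gamma> t $ i"])
qed

lemma curve_analytic_at_vector_derivative:
  fixes \<gamma> :: "real \<Rightarrow> real ^ 'n::finite"
  assumes "curve_analytic_at \<gamma> s"
  shows "(\<gamma> has_vector_derivative vector_derivative \<gamma> (at s)) (at s)"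
    and "curve_analytic_at (\<lambda>t. vector_derivative \<gamma> (at t)) s"
proof -
  have "\<forall>i. \<exists>f'. real_analytic_at f' s \<and> (\<forall>\<^sub>F t in nhds s. ((\<lambda>t. \<gamma> t $ i) has_real_derivative f' t) (at t))"
  proof
    fix i
    have "real_analytic_at (\<lambda>t. \<gamma> t $ i) s"
      using assms by (simp add: curve_analytic_at_def)
    then obtain f' where "real_analytic_at f' s"
      "\<forall>\<^sub>F t in nhds s. ((\<lambda>t. \<gamma> t $ i) has_real_derivative f' t) (at t)"
      by (rule real_analytic_at_derivative)
    then show "\<exists>f'. real_analytic_at f' s \<and> (\<forall>\<^sub>F t in nhds s. ((\<lambda>t. \<gamma> t $ i) has_real_derivative f' t) (at t))"
      by blast
  qed
  then obtain d where d: "\<And>i. real_analytic_at (d i) s"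
    "\<And>i. \<forall>\<^sub>F t in nhds s. ((\<lambda>t. \<gamma> t $ i) has_real_derivative d i t) (at t)"
    by metis
  have "\<forall>\<^sub>F t in nhds s. \<forall>i\<in>UNIV. ((\<lambda>t. \<gamma> t $ i) has_real_derivative d i t) (at t)"
    using d(2) by (intro eventually_ball_finite) auto
  then have ev: "\<forall>\<^sub>F t in nhds s. (\<gamma> has_vector_derivative (\<chi> i. d i t)) (at t)"
    by eventually_elim (auto intro!: has_vector_derivative_vecI)
  then have "(\<gamma> has_vector_derivative (\<chi> i. d i s)) (at s)"
    by (rule eventually_nhds_x_imp_x)
  then show "(\<gamma> has_vector_derivative vector_derivative \<gamma> (at s)) (at s)"
    using vector_derivative_at by force
  have "\<forall>\<^sub>F t in nhds s. vector_derivative \<gamma> (at t) = (\<chi> i. d i t)"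
    using ev by eventually_elim (rule vector_derivative_at)
  then show "curve_analytic_at (\<lambda>t. vector_derivative \<gamma> (at t)) s"
    by (rule curve_analytic_at_cong[rotated]) (simp add: curve_analytic_at_def d(1))
qed

lemma curve_analytic_at_imp_isCont:
  fixes \<gamma> :: "real \<Rightarrow> real ^ 'n::finite"
  assumes "curve_analytic_at \<gamma> s"
  shows "isCont \<gamma> s"
  using curve_analytic_at_vector_derivative(1)[OF assms] by (rule has_vector_derivative_continuous)

lemma curve_analytic_at_scaleR:
  assumes "real_analytic_at f s" "curve_analytic_at \<gamma> s"
  shows "curve_analytic_at (\<lambda>t. f t *\<^sub>R \<gamma> t) s"
  using assms by (auto simp: curve_analytic_at_def intro!: real_analytic_at_mult)

lemma curve_analytic_at_add:
  assumes "curve_analytic_at \<gamma> s" "curve_analytic_at \<delta> s"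
  shows "curve_analytic_at (\<lambda>t. \<gamma> t + \<delta> t) s"
  using assms by (auto simp: curve_analytic_at_def intro!: real_analytic_at_add)

lemma curve_analytic_at_compose:
  assumes "real_analytic_at f s" "curve_analytic_at \<gamma> (f s)"
  shows "curve_analytic_at (\<lambda>t. \<gamma> (f t)) s"
  using assms unfolding curve_analytic_at_def
  by (auto intro: real_analytic_at_compose[where f = "\<lambda>t. \<gamma> t $ i" for i])

lemma real_analytic_at_inner:
  fixes \<gamma> \<delta> :: "real \<Rightarrow> real ^ 'n::finite"
  assumes "curve_analytic_at \<gamma> s" "curve_analytic_at \<delta> s"
  shows "real_analytic_at (\<lambda>t. \<gamma> t \<bullet> \<delta> t) s"
  using assms unfolding inner_vec_def inner_real_def
  by (auto simp: curve_analytic_at_def intro!: real_analytic_at_sum real_analytic_at_mult)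

lemma curve_analytic_at_cross3:
  assumes "curve_analytic_at \<gamma> s" "curve_analytic_at \<delta> s"
  shows "curve_analytic_at (\<lambda>t. cross3 (\<gamma> t) (\<delta> t)) s"
  using assms unfolding curve_analytic_at_def forall_3
  by (simp add: cross3_def real_analytic_at_diff real_analytic_at_mult)

section \<open>The analytic Frenet frame of an arc length curve\<close>

lemma arclength_curve_frame:
  assumes \<gamma>: "arclength_curve I \<gamma>" and s: "s \<in> I"
  shows "curve_analytic_at \<gamma> s" "curve_analytic_at (frame_T \<gamma>) s" "curve_analytic_at (frame_N \<gamma>) s"
    and "(\<gamma> has_vector_derivative frame_T \<gamma> s) (at s)"
    and "(frame_T \<gamma> has_vector_derivative frame_N \<gamma> s) (at s)"
    and "frame_T \<gamma> s \<bullet> frame_T \<gamma> s = 1" "frame_T \<gamma> s \<bullet> frame_N \<gamma> s = 0"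
    and "\<forall>\<^sub>F t in at s. frame_N \<gamma> t \<noteq> 0"
proof -
  have an: "curve_analytic_at \<gamma> t" if "t \<in> I" for t
    using \<gamma> that by (simp add: arclength_curve_def real_analytic_on_curve_iff)
  have anT: "curve_analytic_at (frame_T \<gamma>) t" if "t \<in> I" for t
    using curve_analytic_at_vector_derivative(2)[OF an[OF that]] by (simp flip: frame_T_def)
  have anN: "curve_analytic_at (frame_N \<gamma>) t" if "t \<in> I" for t
    using curve_analytic_at_vector_derivative(2)[OF anT[OF that]] by (simp flip: frame_N_def)
  show "curve_analytic_at \<gamma> s" "curve_analytic_at (frame_T \<gamma>) s" "curve_analytic_at (frame_N \<gamma>) s"
    using an anT anN s by auto
  show "(\<gamma> has_vector_derivative frame_T \<gamma> s) (at s)"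
    using curve_analytic_at_vector_derivative(1)[OF an[OF s]] by (simp flip: frame_T_def)
  show T': "(frame_T \<gamma> has_vector_derivative frame_N \<gamma> s) (at s)"
    using curve_analytic_at_vector_derivative(1)[OF anT[OF s]] by (simp flip: frame_N_def)
  have unit: "frame_T \<gamma> t \<bullet> frame_T \<gamma> t = 1" if "t \<in> I" for t
    using \<gamma> that by (simp add: arclength_curve_def norm_eq_1)
  show "frame_T \<gamma> s \<bullet> frame_T \<gamma> s = 1" using unit s .
  have I: "open I" "connected I"
    using \<gamma> by (auto simp: arclength_curve_def is_interval_connected)
  have "((\<lambda>t. frame_T \<gamma> t \<bullet> frame_T \<gamma> t) has_vector_derivative
      frame_T \<gamma> s \<bullet> frame_N \<gamma> s + frame_N \<gamma> s \<bullet> frame_T \<gamma> s) (at s)"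
    by (rule bounded_bilinear.has_vector_derivative[OF bounded_bilinear_inner T' T'])
  then have "((\<lambda>t. 1) has_vector_derivative
      frame_T \<gamma> s \<bullet> frame_N \<gamma> s + frame_N \<gamma> s \<bullet> frame_T \<gamma> s) (at s)"
    by (rule has_vector_derivative_transform_within_open[OF _ I(1) s unit])
  then have "frame_T \<gamma> s \<bullet> frame_N \<gamma> s + frame_N \<gamma> s \<bullet> frame_T \<gamma> s = 0"
    using vector_derivative_unique_at has_vector_derivative_const by blast
  then show "frame_T \<gamma> s \<bullet> frame_N \<gamma> s = 0" by (simp add: inner_commute)
  obtain s0 where s0: "s0 \<in> I" "frame_N \<gamma> s0 \<noteq> 0"
    using \<gamma> by (auto simp: arclength_curve_def)
  have "\<forall>\<^sub>F t in at s. frame_N \<gamma> t \<bullet> frame_N \<gamma> t \<noteq> 0"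
    by (rule real_analytic_identity[OF I _ s0(1) _ s]) (use s0 anN in \<open>auto intro: real_analytic_at_inner\<close>)
  then show "\<forall>\<^sub>F t in at s. frame_N \<gamma> t \<noteq> 0" by simp
qed

text \<open>With \<open>b = t \<times> n\<close>, the double product \<open>b \<times> (x \<times> b) = x - (b \<bullet> x) b\<close> is the projection of \<open>x\<close> to the
  plane of \<open>t\<close> and \<open>n\<close>; expanding the inner product first yields its two coordinates.\<close>

lemma orthonormal_expansion_cross3:
  fixes t n x :: "real ^ 3"
  assumes "t \<bullet> t = 1" "n \<bullet> n = 1" "t \<bullet> n = 0"
  shows "x = (x \<bullet> t) *\<^sub>R t + (x \<bullet> n) *\<^sub>R n + (x \<bullet> cross3 t n) *\<^sub>R cross3 t n"
    and "cross3 t n \<bullet> cross3 t n = 1" "cross3 t (cross3 t n) = - n"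
proof -
  show bb: "cross3 t n \<bullet> cross3 t n = 1"
    using assms by (simp add: dot_cross inner_commute)
  show *: "cross3 t (cross3 t n) = - n"
    using assms by (simp add: Lagrange)
  have bt: "cross3 (cross3 t n) t = n"
    using * by (metis cross_skew minus_minus)
  have bn: "cross3 (cross3 t n) n = - t"
    using Lagrange[of n t n] assms by (simp add: inner_commute cross_skew[of "cross3 t n" n])
  have "cross3 (cross3 t n) (cross3 x (cross3 t n)) = x - (cross3 t n \<bullet> x) *\<^sub>R cross3 t n"
    using Lagrange[of "cross3 t n" x "cross3 t n"] by (simp add: bb)
  moreover have "cross3 x (cross3 t n) = (x \<bullet> n) *\<^sub>R t - (x \<bullet> t) *\<^sub>R n"
    by (simp add: Lagrange)
  ultimately have "x - (cross3 t n \<bullet> x) *\<^sub>R cross3 t n = (x \<bullet> n) *\<^sub>R n + (x \<bullet> t) *\<^sub>R t"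
    by (simp add: cross_minus_right Cross3.right_diff_distrib cross_mult_right bt bn)
  then show "x = (x \<bullet> t) *\<^sub>R t + (x \<bullet> n) *\<^sub>R n + (x \<bullet> cross3 t n) *\<^sub>R cross3 t n"
    by (simp add: inner_commute algebra_simps)
qed

text \<open>The locale fixes a unit normal field \<open>n\<close> that is analytic on all of \<open>J\<close>. At a zero of \<open>\<kappa>\<close> the
  equation for \<open>frame_N\<close> says nothing about \<open>n s\<close>, which is then determined by continuity.\<close>

locale frenet_curve =
  fixes J :: "real set" and \<psi> :: "real \<Rightarrow> real ^ 3" and \<kappa> :: "real \<Rightarrow> real" and n :: "real \<Rightarrow> real ^ 3"
  assumes arclength: "arclength_curve J \<psi>"
    and curvature: "is_curvature J \<psi> \<kappa>"
    and n_analytic: "s \<in> J \<Longrightarrow> curve_analytic_at n s"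
    and frame_N_eq: "s \<in> J \<Longrightarrow> frame_N \<psi> s = \<kappa> s *\<^sub>R n s"
begin

abbreviation "t \<equiv> frame_T \<psi>"
abbreviation "\<tau> \<equiv> torsion \<psi>"
definition "b s = cross3 (t s) (n s)"

lemma J: "open J" "is_interval J" "J \<noteq> {}"
  using arclength by (auto simp: arclength_curve_def)

lemma curvature_analytic: "s \<in> J \<Longrightarrow> real_analytic_at \<kappa> s"
  using curvature by (simp add: is_curvature_def real_analytic_on_real_iff)

lemma eventually_in_J: "s \<in> J \<Longrightarrow> \<forall>\<^sub>F x in nhds s. x \<in> J"
  using J(1) by (rule eventually_nhds_in_open)

lemma eventually_at_in_J: "s \<in> J \<Longrightarrow> \<forall>\<^sub>F x in at s. x \<in> J"
  using eventually_in_J[of s] unfolding eventually_at_filter by (auto elim: eventually_mono)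

lemma curvature_isolated_zeros:
  assumes "s \<in> J"
  shows "\<forall>\<^sub>F x in at s. x \<in> J \<and> \<kappa> x \<noteq> 0"
  using arclength_curve_frame(8)[OF arclength assms] eventually_at_in_J[OF assms]
  by eventually_elim (auto simp: frame_N_eq)

lemma t_unit: "s \<in> J \<Longrightarrow> t s \<bullet> t s = 1"
  by (rule arclength_curve_frame(6)[OF arclength])

text \<open>Where \<open>\<kappa>\<close> does not vanish, divide \<open>N \<bullet> N = \<kappa>\<^sup>2\<close> by \<open>\<kappa>\<^sup>2\<close>; the other points follow by continuity.\<close>

lemma n_unit:
  assumes s: "s \<in> J"
  shows "n s \<bullet> n s = 1"
proof -
  have "n s \<bullet> n s - 1 = 0"
  proof (rule isCont_eq_zeroI[where f = "\<lambda>x. n x \<bullet> n x - 1"])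
    show "isCont (\<lambda>x. n x \<bullet> n x - 1) s"
      by (intro continuous_intros curve_analytic_at_imp_isCont n_analytic s)
    show "\<forall>\<^sub>F x in at s. n x \<bullet> n x - 1 = 0"
      using curvature_isolated_zeros[OF s]
    proof eventually_elim
      case (elim x)
      have "(\<kappa> x)\<^sup>2 = frame_N \<psi> x \<bullet> frame_N \<psi> x"
        using curvature elim by (simp add: is_curvature_def)
      then show ?case using elim by (simp add: frame_N_eq power2_eq_square)
    qed
  qed
  then show ?thesis by simp
qed

lemma t_n:
  assumes s: "s \<in> J"
  shows "t s \<bullet> n s = 0"
proof (rule isCont_eq_zeroI[where f = "\<lambda>x. t x \<bullet> n x"])
  show "isCont (\<lambda>x. t x \<bullet> n x) s"
    by (intro continuous_intros curve_analytic_at_imp_isCont n_analytic arclength_curve_frame(2)[OF arclength] s)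
  show "\<forall>\<^sub>F x in at s. t x \<bullet> n x = 0"
    using curvature_isolated_zeros[OF s]
  proof eventually_elim
    case (elim x)
    have "t x \<bullet> frame_N \<psi> x = 0"
      using arclength_curve_frame(7)[OF arclength] elim by blast
    then show ?case using elim by (simp add: frame_N_eq)
  qed
qed

lemma b_unit: "s \<in> J \<Longrightarrow> b s \<bullet> b s = 1"
  unfolding b_def by (intro orthonormal_expansion_cross3(2) t_unit n_unit t_n)

lemma t_b: "t s \<bullet> b s = 0" and n_b: "n s \<bullet> b s = 0"
  by (simp_all add: b_def dot_cross_self)

lemma frame_expansion:
  "s \<in> J \<Longrightarrow> x = (x \<bullet> t s) *\<^sub>R t s + (x \<bullet> n s) *\<^sub>R n s + (x \<bullet> b s) *\<^sub>R b s"
  unfolding b_def by (intro orthonormal_expansion_cross3(1) t_unit n_unit t_n)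

lemma frame_B_eq: "s \<in> J \<Longrightarrow> frame_B \<psi> s = \<kappa> s *\<^sub>R b s"
  by (simp add: frame_B_def frame_N_eq b_def cross_mult_right)

lemma b_analytic: "s \<in> J \<Longrightarrow> curve_analytic_at b s"
  unfolding b_def by (intro curve_analytic_at_cross3 n_analytic arclength_curve_frame(2)[OF arclength])

lemma \<psi>_deriv: "s \<in> J \<Longrightarrow> (\<psi> has_vector_derivative t s) (at s)"
  by (rule arclength_curve_frame(4)[OF arclength])

lemma t_deriv: "s \<in> J \<Longrightarrow> (t has_vector_derivative \<kappa> s *\<^sub>R n s) (at s)"
  using arclength_curve_frame(5)[OF arclength] by (simp add: frame_N_eq)

text \<open>Differentiating \<open>n \<bullet> n = 1\<close> and \<open>t \<bullet> n = 0\<close> gives the first two coordinates of \<open>n'\<close> in the frame.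
  The third is identified with the torsion only in the next lemma.\<close>

lemma n_deriv_aux:
  assumes s: "s \<in> J"
  shows "(n has_vector_derivative - \<kappa> s *\<^sub>R t s + (vector_derivative n (at s) \<bullet> b s) *\<^sub>R b s) (at s)"
proof -
  let ?d = "vector_derivative n (at s)"
  have n': "(n has_vector_derivative ?d) (at s)"
    by (rule curve_analytic_at_vector_derivative(1)[OF n_analytic[OF s]])
  have zero: "d = 0" if "((\<lambda>x. f x) has_vector_derivative d) (at s)" "\<And>x. x \<in> J \<Longrightarrow> f x = c"
    for f :: "real \<Rightarrow> real" and c d
  proof -
    have "((\<lambda>x. c) has_vector_derivative d) (at s)"
      by (rule has_vector_derivative_transform_within_open[OF that(1) J(1) s that(2)])
    then show ?thesis
      using vector_derivative_unique_at has_vector_derivative_const by blast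
  qed
  have "n s \<bullet> ?d + ?d \<bullet> n s = 0"
    by (rule zero[OF bounded_bilinear.has_vector_derivative[OF bounded_bilinear_inner n' n'] n_unit])
  then have nd: "?d \<bullet> n s = 0" by (simp add: inner_commute)
  have "t s \<bullet> ?d + (\<kappa> s *\<^sub>R n s) \<bullet> n s = 0"
    by (rule zero[OF bounded_bilinear.has_vector_derivative[OF bounded_bilinear_inner t_deriv[OF s] n'] t_n])
  then have td: "?d \<bullet> t s = - \<kappa> s" by (simp add: inner_commute n_unit s)
  have "?d = - \<kappa> s *\<^sub>R t s + (?d \<bullet> b s) *\<^sub>R b s"
    using frame_expansion[OF s, of ?d] by (simp add: nd td)
  then show ?thesis using n' by simp
qed

text \<open>With \<open>N = \<kappa> n\<close> the determinant in the torsion quotient equals \<open>\<kappa>\<^sup>2 (n' \<bullet> b)\<close>. So the quotient is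
  \<open>n' \<bullet> b\<close> wherever \<open>\<kappa>\<close> does not vanish, and its limit at a zero of \<open>\<kappa>\<close> is the value of the continuous
  function \<open>n' \<bullet> b\<close>.\<close>

lemma torsion_eq:
  assumes s: "s \<in> J"
  shows "\<tau> s = vector_derivative n (at s) \<bullet> b s"
proof -
  define \<omega> where "\<omega> x = vector_derivative n (at x) \<bullet> b x" for x
  have quot: "torsion_quotient \<psi> x = \<omega> x" if x: "x \<in> J" "\<kappa> x \<noteq> 0" for x
  proof -
    let ?d = "vector_derivative n (at x)"
    obtain \<kappa>' where "\<forall>\<^sub>F y in nhds x. (\<kappa> has_real_derivative \<kappa>' y) (at y)"
      by (rule real_analytic_at_derivative[OF curvature_analytic[OF x(1)]])
    then have \<kappa>': "(\<kappa> has_real_derivative \<kappa>' x) (at x)"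
      by (rule eventually_nhds_x_imp_x)
    have "((\<lambda>y. \<kappa> y *\<^sub>R n y) has_vector_derivative \<kappa> x *\<^sub>R ?d + \<kappa>' x *\<^sub>R n x) (at x)"
      by (rule has_vector_derivative_scaleR[OF \<kappa>' curve_analytic_at_vector_derivative(1)[OF n_analytic[OF x(1)]]])
    then have "(frame_N \<psi> has_vector_derivative \<kappa> x *\<^sub>R ?d + \<kappa>' x *\<^sub>R n x) (at x)"
      by (rule has_vector_derivative_transform_within_open[OF _ J(1) x(1)]) (simp add: frame_N_eq)
    then have N': "vector_derivative (frame_N \<psi>) (at x) = \<kappa> x *\<^sub>R ?d + \<kappa>' x *\<^sub>R n x"
      by (rule vector_derivative_at)
    have "t x \<bullet> cross3 (n x) ?d = \<omega> x"
      unfolding \<omega>_def b_def by (simp add: cross3_simps)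
    then have "t x \<bullet> cross3 (\<kappa> x *\<^sub>R n x) (\<kappa> x *\<^sub>R ?d + \<kappa>' x *\<^sub>R n x) = (\<kappa> x)\<^sup>2 * \<omega> x"
      by (simp add: cross_add_right cross_mult_left cross_mult_right power2_eq_square)
    moreover have "(norm (\<kappa> x *\<^sub>R n x))\<^sup>2 = (\<kappa> x)\<^sup>2"
      by (simp add: power_mult_distrib power2_norm_eq_inner n_unit x)
    ultimately show ?thesis
      unfolding torsion_quotient_def N' dot_cross_det[symmetric] frame_N_eq[OF x(1)]
      using x by simp
  qed
  have "real_analytic_at \<omega> s"
    unfolding \<omega>_def
    by (intro real_analytic_at_inner curve_analytic_at_vector_derivative(2) n_analytic b_analytic s)
  then have "(\<omega> \<longlongrightarrow> \<omega> s) (at s)"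
    using real_analytic_at_imp_isCont by (simp add: isCont_def)
  moreover have "\<forall>\<^sub>F x in at s. \<omega> x = torsion_quotient \<psi> x"
    using curvature_isolated_zeros[OF s] by eventually_elim (simp add: quot)
  ultimately have "(torsion_quotient \<psi> \<longlongrightarrow> \<omega> s) (at s)"
    by (rule Lim_transform_eventually)
  then have "Lim (at s) (torsion_quotient \<psi>) = \<omega> s"
    by (intro tendsto_Lim) auto
  then show ?thesis
    using quot[OF s] s by (auto simp: torsion_def frame_N_eq \<omega>_def)
qed

lemma torsion_analytic:
  assumes "s \<in> J"
  shows "real_analytic_at \<tau> s"
proof (rule real_analytic_at_cong)
  show "real_analytic_at (\<lambda>x. vector_derivative n (at x) \<bullet> b x) s"
    by (intro real_analytic_at_inner curve_analytic_at_vector_derivative(2) n_analytic b_analytic assms)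
  show "\<forall>\<^sub>F x in nhds s. \<tau> x = vector_derivative n (at x) \<bullet> b x"
    using eventually_in_J[OF assms] by eventually_elim (rule torsion_eq)
qed

lemma n_deriv: "s \<in> J \<Longrightarrow> (n has_vector_derivative - \<kappa> s *\<^sub>R t s + \<tau> s *\<^sub>R b s) (at s)"
  using n_deriv_aux by (simp add: torsion_eq)

lemma b_deriv:
  assumes s: "s \<in> J"
  shows "(b has_vector_derivative - \<tau> s *\<^sub>R n s) (at s)"
proof -
  have "bounded_bilinear cross3"
    using bilinear_cross by (simp add: bilinear_conv_bounded_bilinear)
  from bounded_bilinear.has_vector_derivative[OF this t_deriv[OF s] n_deriv[OF s]]
  have "(b has_vector_derivative
      cross3 (t s) (- \<kappa> s *\<^sub>R t s + \<tau> s *\<^sub>R b s) + cross3 (\<kappa> s *\<^sub>R n s) (n s)) (at s)"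
    unfolding b_def .
  moreover have "cross3 (t s) (b s) = - n s"
    unfolding b_def by (intro orthonormal_expansion_cross3(3) t_unit n_unit t_n s)
  ultimately show ?thesis
    by (simp add: cross_add_right Cross3.right_diff_distrib cross_mult_left cross_mult_right)
qed

end

text \<open>Each component of the normal vector \<open>N\<close> of \<open>\<psi>\<close> is bounded by \<open>\<bar>\<kappa>\<bar> = \<parallel>N\<parallel>\<close>, so its quotient by \<open>\<kappa>\<close> has a removable
  singularity. The normal field is defined globally as this quotient, and by its limit at
  the zeros of \<open>\<kappa>\<close>.\<close>

lemma frenet_curve_exists:
  assumes \<psi>: "arclength_curve J \<psi>" and \<kappa>: "is_curvature J \<psi> \<kappa>"
  obtains n where "frenet_curve J \<psi> \<kappa> n"
proof -
  define q where "q s = (1 / \<kappa> s) *\<^sub>R frame_N \<psi> s" for s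
  define n where "n s = (if \<kappa> s \<noteq> 0 then q s else Lim (at s) q)" for s
  have norm: "\<bar>\<kappa> s\<bar> = norm (frame_N \<psi> s)" if "s \<in> J" for s
    using \<kappa> that by (auto simp: is_curvature_def norm_eq_sqrt_inner simp flip: real_sqrt_abs)
  have "curve_analytic_at n s \<and> frame_N \<psi> s = \<kappa> s *\<^sub>R n s" if s: "s \<in> J" for s
  proof -
    have inJ: "\<forall>\<^sub>F x in nhds s. x \<in> J"
      using \<psi> s by (intro eventually_nhds_in_open) (auto simp: arclength_curve_def)
    have nz: "\<forall>\<^sub>F x in at s. \<kappa> x \<noteq> 0"
    proof -
      have "\<forall>\<^sub>F x in at s. x \<in> J"
        using inJ unfolding eventually_at_filter by eventually_elim simp
      with arclength_curve_frame(8)[OF \<psi> s] show ?thesis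
        by eventually_elim (use norm in force)
    qed
    have \<kappa>an: "real_analytic_at \<kappa> s"
      using \<kappa> s by (simp add: is_curvature_def real_analytic_on_real_iff)
    have \<kappa>nz: "\<not> (\<forall>\<^sub>F x in nhds s. \<kappa> x = 0)"
    proof
      assume "\<forall>\<^sub>F x in nhds s. \<kappa> x = 0"
      then have "\<forall>\<^sub>F x in at s. \<kappa> x = 0"
        unfolding eventually_at_filter by eventually_elim simp
      with nz have "\<forall>\<^sub>F x in at s. False" by eventually_elim simp
      then show False by simp
    qed
    have "\<exists>q. real_analytic_at q s \<and> (\<forall>\<^sub>F x in nhds s. frame_N \<psi> x $ i = \<kappa> x * q x)" for i
    proof -
      have "real_analytic_at (\<lambda>x. frame_N \<psi> x $ i) s"
        using arclength_curve_frame(3)[OF \<psi> s] by (simp add: curve_analytic_at_def)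
      moreover have "\<forall>\<^sub>F x in nhds s. \<bar>frame_N \<psi> x $ i\<bar> \<le> \<bar>\<kappa> x\<bar>"
        using inJ by eventually_elim (simp add: norm component_le_norm_cart)
      ultimately obtain q where "real_analytic_at q s" "\<forall>\<^sub>F x in nhds s. frame_N \<psi> x $ i = \<kappa> x * q x"
        using real_analytic_at_removable_quotient[OF _ \<kappa>an \<kappa>nz] by blast
      then show ?thesis by blast
    qed
    then obtain p where p: "\<And>i. real_analytic_at (p i) s"
      "\<And>i. \<forall>\<^sub>F x in nhds s. frame_N \<psi> x $ i = \<kappa> x * p i x"
      by metis
    define r where "r x = (\<chi> i. p i x)" for x
    have r: "curve_analytic_at r s"
      by (simp add: curve_analytic_at_def r_def p)
    have "\<forall>\<^sub>F x in nhds s. \<forall>i\<in>UNIV. frame_N \<psi> x $ i = \<kappa> x * p i x"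
      using p(2) by (intro eventually_ball_finite) auto
    then have Nr: "\<forall>\<^sub>F x in nhds s. frame_N \<psi> x = \<kappa> x *\<^sub>R r x"
      by eventually_elim (simp add: vec_eq_iff r_def)
    then have "\<forall>\<^sub>F x in nhds s. \<kappa> x \<noteq> 0 \<longrightarrow> q x = r x"
      by eventually_elim (simp add: q_def)
    then have qr: "\<forall>\<^sub>F x in nhds s. x \<noteq> s \<or> \<kappa> s \<noteq> 0 \<longrightarrow> \<kappa> x \<noteq> 0 \<and> q x = r x"
      using nz unfolding eventually_at_filter by eventually_elim auto
    have ns: "n s = r s"
    proof (cases "\<kappa> s = 0")
      case True
      have "\<forall>\<^sub>F x in at s. r x = q x"
        using qr unfolding eventually_at_filter by eventually_elim auto
      moreover have "(r \<longlongrightarrow> r s) (at s)"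
        using curve_analytic_at_imp_isCont[OF r] by (simp add: isCont_def)
      ultimately have "(q \<longlongrightarrow> r s) (at s)"
        by (rule Lim_transform_eventually[rotated])
      then show ?thesis
        using True by (simp add: n_def tendsto_Lim)
    next
      case False
      then show ?thesis
        using eventually_nhds_x_imp_x[OF qr] by (simp add: n_def)
    qed
    have "\<forall>\<^sub>F x in nhds s. n x = r x"
      using qr by eventually_elim (use ns in \<open>auto simp: n_def\<close>)
    from curve_analytic_at_cong[OF r this] show ?thesis
      using eventually_nhds_x_imp_x[OF Nr] ns by simp
  qed
  then show ?thesis
    by (intro that[of n] frenet_curve.intro \<psi> \<kappa>) auto
qed

context frenet_curve
begin

section \<open>From a Mannheim pair to the torsion equation\<close>

text \<open>The coordinates \<open>u = T \<bullet> t\<close> and \<open>w = T \<bullet> n\<close> of the tangent of \<open>\<phi>\<close> satisfy \<open>u' = \<kappa> w\<close> and \<open>w' = - \<kappa> u\<close>,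
  since \<open>N\<close> is parallel to \<open>b\<close> and \<open>T\<close> is orthogonal to it. The quotient rule applied to
  \<open>\<tau> = - w / (a u)\<close> then gives the equation. The speed \<open>h'\<close> of the
  correspondence cancels in the quotient \<open>w / u\<close>.\<close>

lemma mannheim_imp_torsion_ode:
  assumes "mannheim_pair I \<phi> J \<psi>"
  shows "\<exists>a. a \<noteq> 0 \<and> (\<forall>s\<in>J. (\<tau> has_real_derivative \<kappa> s / a * (1 + a\<^sup>2 * (\<tau> s)\<^sup>2)) (at s))"
proof -
  obtain h where \<phi>: "arclength_curve I \<phi>" and bij: "bij_betw h J I" and diff: "h differentiable_on J"
    and lines: "\<And>s. s \<in> J \<Longrightarrow> frame_N \<phi> (h s) \<noteq> 0 \<Longrightarrow> frame_B \<psi> s \<noteq> 0 \<Longrightarrow>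
      principal_normal_line \<phi> (h s) = binormal_line \<psi> s"
    using assms unfolding mannheim_pair_def by blast
  define T N where "T s = frame_T \<phi> (h s)" and "N s = frame_N \<phi> (h s)" for s
  have hI: "h s \<in> I" if "s \<in> J" for s
    using bij that bij_betwE by blast
  have "\<exists>d. (h has_real_derivative d) (at s)" if "s \<in> J" for s
    using diff that J(1) by (metis at_within_open differentiable_on_def real_differentiable_def)
  then obtain h' where h': "\<And>s. s \<in> J \<Longrightarrow> (h has_real_derivative h' s) (at s)"
    by metis
  note h'v = h'[unfolded has_real_derivative_iff_has_vector_derivative]
  have \<phi>h: "((\<lambda>x. \<phi> (h x)) has_vector_derivative h' s *\<^sub>R T s) (at s)"
    and T': "(T has_vector_derivative h' s *\<^sub>R N s) (at s)" if s: "s \<in> J" for s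
    using vector_diff_chain_at[OF h'v[OF s] arclength_curve_frame(4)[OF \<phi> hI[OF s]]]
      vector_diff_chain_at[OF h'v[OF s] arclength_curve_frame(5)[OF \<phi> hI[OF s]]]
    by (simp_all add: T_def[abs_def] N_def o_def)
  have Ncont: "isCont N s" if s: "s \<in> J" for s
    unfolding N_def
    by (rule isCont_o2[OF DERIV_isCont[OF h'[OF s]]])
      (rule curve_analytic_at_imp_isCont[OF arclength_curve_frame(3)[OF \<phi> hI[OF s]]])
  have good: "\<forall>\<^sub>F x in at s. x \<in> J \<and> \<kappa> x \<noteq> 0 \<and> N x \<noteq> 0" if s: "s \<in> J" for s
  proof -
    \<comment> \<open>injectivity makes the points that \<open>h\<close> sends to zeros of the normal of \<open>\<phi>\<close> isolated\<close>
    have "\<forall>\<^sub>F x in at s. h x \<noteq> h s"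
      using eventually_at_in_J[OF s] unfolding eventually_at_filter
      by eventually_elim (use bij s in \<open>auto simp: bij_betw_def inj_on_def\<close>)
    moreover have "(h \<longlongrightarrow> h s) (at s)"
      using DERIV_isCont[OF h'[OF s]] by (simp add: isCont_def)
    ultimately have "filterlim h (at (h s)) (at s)"
      by (simp add: filterlim_at)
    then have "\<forall>\<^sub>F x in at s. N x \<noteq> 0"
      using arclength_curve_frame(8)[OF \<phi> hI[OF s]] by (auto simp: filterlim_iff N_def)
    with curvature_isolated_zeros[OF s] show ?thesis
      by eventually_elim auto
  qed
  define \<delta> where "\<delta> s = \<phi> (h s) - \<psi> s" for s
  have \<delta>': "(\<delta> has_vector_derivative h' s *\<^sub>R T s - t s) (at s)" if s: "s \<in> J" for s
    unfolding \<delta>_def by (intro has_vector_derivative_diff \<phi>h \<psi>_deriv s)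
  have \<delta>_good: "\<exists>u. \<delta> s = u *\<^sub>R b s" and N_good: "\<exists>u. N s = u *\<^sub>R b s"
    if s: "s \<in> J" "\<kappa> s \<noteq> 0" "N s \<noteq> 0" for s
  proof -
    have "frame_B \<psi> s \<noteq> 0"
      using s b_unit[OF s(1)] by (auto simp: frame_B_eq)
    then have eq: "principal_normal_line \<phi> (h s) = binormal_line \<psi> s"
      using lines s by (simp add: N_def)
    \<comment> \<open>the points with parameters 0 and 1 determine the base point and the direction of the line\<close>
    have "\<phi> (h s) + 0 *\<^sub>R N s \<in> binormal_line \<psi> s" "\<phi> (h s) + 1 *\<^sub>R N s \<in> binormal_line \<psi> s"
      unfolding eq[symmetric] principal_normal_line_def N_def by blast+
    then obtain u v where "\<phi> (h s) + 0 *\<^sub>R N s = \<psi> s + u *\<^sub>R frame_B \<psi> s"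
      "\<phi> (h s) + 1 *\<^sub>R N s = \<psi> s + v *\<^sub>R frame_B \<psi> s"
      unfolding binormal_line_def by blast
    then have u: "\<phi> (h s) = \<psi> s + (u * \<kappa> s) *\<^sub>R b s"
      and v: "\<phi> (h s) + N s = \<psi> s + (v * \<kappa> s) *\<^sub>R b s"
      by (simp_all add: frame_B_eq s)
    show "\<exists>u. \<delta> s = u *\<^sub>R b s"
      using u by (auto simp: \<delta>_def)
    have "N s = (v * \<kappa> s - u * \<kappa> s) *\<^sub>R b s"
      using u v by (simp add: algebra_simps)
    then show "\<exists>u. N s = u *\<^sub>R b s" by blast
  qed
  have bcont: "isCont b s" and ncont: "isCont n s" and tcont: "isCont t s" if "s \<in> J" for s
    using that b_analytic n_analytic arclength_curve_frame(2)[OF arclength]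
    by (auto intro: curve_analytic_at_imp_isCont)
  have Tcont: "isCont T s" and \<delta>cont: "isCont \<delta> s" if "s \<in> J" for s
    using T' \<delta>' that has_vector_derivative_continuous by blast+
  have \<delta>_b: "\<delta> s - (\<delta> s \<bullet> b s) *\<^sub>R b s = 0" if s: "s \<in> J" for s
  proof (rule isCont_eq_zeroI[where f = "\<lambda>s. \<delta> s - (\<delta> s \<bullet> b s) *\<^sub>R b s"])
    show "isCont (\<lambda>s. \<delta> s - (\<delta> s \<bullet> b s) *\<^sub>R b s) s"
      by (intro continuous_intros \<delta>cont bcont s)
    show "\<forall>\<^sub>F x in at s. \<delta> x - (\<delta> x \<bullet> b x) *\<^sub>R b x = 0"
      using good[OF s] by eventually_elim (use \<delta>_good b_unit in fastforce)
  qed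
  have T_b: "T s \<bullet> b s = 0" if s: "s \<in> J" for s
  proof (rule isCont_eq_zeroI[where f = "\<lambda>s. T s \<bullet> b s"])
    show "isCont (\<lambda>s. T s \<bullet> b s) s"
      by (intro continuous_intros Tcont bcont s)
    show "\<forall>\<^sub>F x in at s. T x \<bullet> b x = 0"
      using good[OF s]
    proof eventually_elim
      case (elim x)
      then obtain u where u: "N x = u *\<^sub>R b x" using N_good by blast
      have "T x \<bullet> N x = 0"
        using arclength_curve_frame(7)[OF \<phi> hI] elim by (simp add: T_def N_def)
      then show ?case using u elim by auto
    qed
  qed
  have N_t: "N s \<bullet> t s = 0" if s: "s \<in> J" for s
  proof (rule isCont_eq_zeroI[where f = "\<lambda>s. N s \<bullet> t s"])
    show "isCont (\<lambda>s. N s \<bullet> t s) s"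
      by (intro continuous_intros Ncont tcont s)
    show "\<forall>\<^sub>F x in at s. N x \<bullet> t x = 0"
      using good[OF s] by eventually_elim (use N_good t_b in \<open>fastforce simp: inner_commute\<close>)
  qed
  have N_n: "N s \<bullet> n s = 0" if s: "s \<in> J" for s
  proof (rule isCont_eq_zeroI[where f = "\<lambda>s. N s \<bullet> n s"])
    show "isCont (\<lambda>s. N s \<bullet> n s) s"
      by (intro continuous_intros Ncont ncont s)
    show "\<forall>\<^sub>F x in at s. N x \<bullet> n x = 0"
      using good[OF s] by eventually_elim (use N_good n_b in \<open>fastforce simp: inner_commute\<close>)
  qed
  \<comment> \<open>the distance from \<open>\<psi>\<close> to \<open>\<phi>\<close> along \<open>b\<close> is constant because both tangents are orthogonal to \<open>b\<close>\<close>
  have "((\<lambda>x. \<delta> x \<bullet> b x) has_real_derivative 0) (at s within J)" if s: "s \<in> J" for s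
  proof -
    have "\<delta> s = (\<delta> s \<bullet> b s) *\<^sub>R b s"
      using \<delta>_b[OF s] by simp
    from arg_cong[OF this, of "\<lambda>v. v \<bullet> n s"] have "\<delta> s \<bullet> n s = (\<delta> s \<bullet> b s) * (b s \<bullet> n s)"
      by simp
    also have "\<dots> = 0"
      using n_b[of s] by (simp add: inner_commute)
    finally have "\<delta> s \<bullet> n s = 0" .
    moreover have "((\<lambda>x. \<delta> x \<bullet> b x) has_vector_derivative
        \<delta> s \<bullet> (- \<tau> s *\<^sub>R n s) + (h' s *\<^sub>R T s - t s) \<bullet> b s) (at s)"
      by (rule bounded_bilinear.has_vector_derivative[OF bounded_bilinear_inner \<delta>'[OF s] b_deriv[OF s]])
    ultimately show ?thesis
      using T_b[OF s]
      by (simp add: has_real_derivative_iff_has_vector_derivative inner_diff_left t_b has_vector_derivative_at_within)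
  qed
  then obtain a where a: "\<And>s. s \<in> J \<Longrightarrow> \<delta> s \<bullet> b s = a"
    using has_field_derivative_zero_constant[of J "\<lambda>x. \<delta> x \<bullet> b x"] J(2) is_interval_convex by blast
  have hT: "h' s *\<^sub>R T s = t s - (a * \<tau> s) *\<^sub>R n s" if s: "s \<in> J" for s
  proof -
    have "((\<lambda>x. a *\<^sub>R b x) has_vector_derivative a *\<^sub>R (- \<tau> s *\<^sub>R n s)) (at s)"
      by (rule bounded_linear.has_vector_derivative[OF bounded_linear_scaleR_right b_deriv[OF s]])
    moreover have "((\<lambda>x. a *\<^sub>R b x) has_vector_derivative h' s *\<^sub>R T s - t s) (at s)"
      by (rule has_vector_derivative_transform_within_open[OF \<delta>'[OF s] J(1) s]) (use \<delta>_b a in fastforce)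
    ultimately have "a *\<^sub>R (- \<tau> s *\<^sub>R n s) = h' s *\<^sub>R T s - t s"
      using vector_derivative_unique_at by blast
    then show ?thesis by (simp add: algebra_simps)
  qed
  define u w where "u s = T s \<bullet> t s" and "w s = T s \<bullet> n s" for s
  have u: "h' s * u s = 1" and w: "h' s * w s = - (a * \<tau> s)" if s: "s \<in> J" for s
    using arg_cong[OF hT[OF s], of "\<lambda>v. v \<bullet> t s"] arg_cong[OF hT[OF s], of "\<lambda>v. v \<bullet> n s"]
    using t_n[OF s] by (simp_all add: u_def w_def inner_diff_left t_unit n_unit s inner_commute[of "n s" "t s"])
  have u': "(u has_real_derivative \<kappa> s * w s) (at s)"
    and w': "(w has_real_derivative - \<kappa> s * u s) (at s)" if s: "s \<in> J" for s
    using bounded_bilinear.has_vector_derivative[OF bounded_bilinear_inner T'[OF s] t_deriv[OF s]]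
      bounded_bilinear.has_vector_derivative[OF bounded_bilinear_inner T'[OF s] n_deriv[OF s]]
    by (simp_all add: has_real_derivative_iff_has_vector_derivative u_def[abs_def] w_def[abs_def]
        N_t N_n T_b s inner_add_right inner_diff_right)
  have u_nz: "u s \<noteq> 0" and w_eq: "w s = - a * \<tau> s * u s" if s: "s \<in> J" for s
  proof -
    show "u s \<noteq> 0" using u[OF s] by auto
    have "w s = (h' s * u s) * w s" by (simp add: u s)
    also have "\<dots> = (h' s * w s) * u s" by simp
    finally show "w s = - a * \<tau> s * u s" by (simp add: w s)
  qed
  \<comment> \<open>for \<open>a = 0\<close> the tangents would be parallel, so \<open>w = 0\<close> and \<open>w' = - \<kappa> u = 0\<close>, although \<open>u\<close> has no zeros and \<open>\<kappa>\<close> only isolated ones\<close>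
  have "a \<noteq> 0"
  proof
    assume "a = 0"
    obtain s0 where s0: "s0 \<in> J" using J(3) by blast
    obtain s where s: "s \<in> J" "\<kappa> s \<noteq> 0"
      using eventually_happens[OF curvature_isolated_zeros[OF s0]] by auto
    have "((\<lambda>_. 0) has_real_derivative - \<kappa> s * u s) (at s)"
      by (rule has_field_derivative_transform_within_open[OF w'[OF s(1)] J(1) s(1)])
        (simp add: w_eq \<open>a = 0\<close>)
    then have "\<kappa> s * u s = 0"
      using DERIV_unique[OF _ DERIV_const] by fastforce
    then show False using s u_nz by simp
  qed
  moreover have "(\<tau> has_real_derivative \<kappa> s / a * (1 + a\<^sup>2 * (\<tau> s)\<^sup>2)) (at s)" if s: "s \<in> J" for s
  proof -
    have "((\<lambda>x. - (w x / u x) / a) has_real_derivative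
        - (((- \<kappa> s * u s) * u s - w s * (\<kappa> s * w s)) / (u s * u s)) / a) (at s)"
      by (intro DERIV_cdivide DERIV_minus DERIV_divide w' u' u_nz s)
    moreover have "- (((- \<kappa> s * u s) * u s - w s * (\<kappa> s * w s)) / (u s * u s)) / a
        = \<kappa> s / a * (1 + a\<^sup>2 * (\<tau> s)\<^sup>2)"
      using u_nz[OF s] \<open>a \<noteq> 0\<close> unfolding w_eq[OF s] by (simp add: field_simps power2_eq_square)
    ultimately have "((\<lambda>x. - (w x / u x) / a) has_real_derivative \<kappa> s / a * (1 + a\<^sup>2 * (\<tau> s)\<^sup>2)) (at s)"
      by simp
    then show ?thesis
      by (rule has_field_derivative_transform_within_open[OF _ J(1) s])
        (use u_nz \<open>a \<noteq> 0\<close> in \<open>simp add: w_eq\<close>)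
  qed
  ultimately show ?thesis by blast
qed

section \<open>From the torsion equation to a Mannheim curve\<close>

text \<open>The curve \<open>\<Phi> = \<psi> + a b\<close> has derivative \<open>t - a \<tau> n\<close> and hence speed \<open>g = sqrt (1 + a\<^sup>2 \<tau>\<^sup>2)\<close>. With
  \<open>c = 1 / g\<close> and \<open>d = a \<tau> / g\<close>, the cosine and the sine of the angle with tangent \<open>a \<tau>\<close>, its unit tangent is
  \<open>V = c t - d n\<close>. The torsion equation amounts to \<open>c' = - \<kappa> d\<close> and \<open>d' = \<kappa> c\<close>, so the \<open>t\<close> and \<open>n\<close>
  coordinates of \<open>V'\<close> cancel and the normal of \<open>\<Phi>\<close> is parallel to \<open>b\<close>.\<close>

lemma torsion_ode_imp_mannheim:
  assumes "a \<noteq> 0"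
    and ode: "\<And>s. s \<in> J \<Longrightarrow> (\<tau> has_real_derivative \<kappa> s / a * (1 + a\<^sup>2 * (\<tau> s)\<^sup>2)) (at s)"
  shows "\<exists>I \<phi>. mannheim_pair I \<phi> J \<psi>"
proof -
  define g where "g s = sqrt (1 + (a * \<tau> s)\<^sup>2)" for s
  have sq_pos: "1 + (a * \<tau> s)\<^sup>2 > 0" for s
    by (simp add: add_pos_nonneg)
  have g_pos: "g s > 0" and g_sq: "g s * g s = 1 + (a * \<tau> s)\<^sup>2" for s
    using sq_pos[of s] by (simp_all add: g_def)
  have g_analytic: "real_analytic_at g s" if "s \<in> J" for s
    unfolding g_def
    by (intro real_analytic_at_sqrt sq_pos real_analytic_at_add real_analytic_at_power real_analytic_at_mult real_analytic_at_const
        torsion_analytic that)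
  have "continuous_on J g"
    using g_analytic real_analytic_at_imp_isCont continuous_at_imp_continuous_on by blast
  then obtain \<sigma> where \<sigma>': "\<And>s. s \<in> J \<Longrightarrow> (\<sigma> has_real_derivative g s) (at s)"
    using antiderivative_on_open_interval[OF J(1,2)] by blast
  have \<sigma>_analytic: "real_analytic_at \<sigma> s" if "s \<in> J" for s
    by (rule real_analytic_at_antiderivative[OF g_analytic[OF that]])
      (use eventually_in_J[OF that] in \<open>auto elim!: eventually_mono intro: \<sigma>'\<close>)
  have \<sigma>_cont: "continuous_on J \<sigma>"
    using \<sigma>' DERIV_isCont continuous_at_imp_continuous_on by blast
  have "\<sigma> x < \<sigma> y" if "x \<in> J" "y \<in> J" "x < y" for x y
  proof (rule DERIV_pos_imp_increasing[OF that(3)])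
    fix z assume "x \<le> z" "z \<le> y"
    then have "z \<in> J" using J(2) that mem_is_interval_1_I by blast
    then show "\<exists>d. (\<sigma> has_real_derivative d) (at z) \<and> d > 0" using \<sigma>' g_pos by blast
  qed
  then have inj: "inj_on \<sigma> J"
    by (intro linorder_inj_onI') force
  define I where "I = \<sigma> ` J"
  define \<eta> where "\<eta> = the_inv_into J \<sigma>"
  have \<eta>\<sigma>: "\<eta> (\<sigma> s) = s" if "s \<in> J" for s
    unfolding \<eta>_def by (rule the_inv_into_f_f[OF inj that])
  have I: "open I" "is_interval I" "I \<noteq> {}"
  proof -
    show "open I" unfolding I_def by (rule invariance_of_domain[OF \<sigma>_cont J(1) inj])
    show "is_interval I"
      unfolding I_def is_interval_connected_1
      by (intro connected_continuous_image \<sigma>_cont) (use J(2) is_interval_connected_1 in blast)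
    show "I \<noteq> {}" using J(3) by (simp add: I_def)
  qed
  have \<eta>': "(\<eta> has_real_derivative 1 / g s) (at (\<sigma> s))" if s: "s \<in> J" for s
    using has_field_derivative_inverse_strong[OF \<sigma>'[OF s] _ J(1) s \<sigma>_cont \<eta>\<sigma>] g_pos[of s]
    by (simp add: inverse_eq_divide)
  have \<eta>_analytic: "real_analytic_at \<eta> (\<sigma> s)" if s: "s \<in> J" for s
  proof (rule real_analytic_at_inverse_function[OF \<sigma>_analytic[OF s] \<sigma>'[OF s]])
    show "g s \<noteq> 0" using g_pos[of s] by simp
    show "isCont \<eta> (\<sigma> s)" using \<eta>'[OF s] by (rule DERIV_isCont)
    show "\<eta> (\<sigma> s) = s" by (rule \<eta>\<sigma>[OF s])
    have "\<forall>\<^sub>F y in nhds (\<sigma> s). y \<in> I"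
      using I s by (intro eventually_nhds_in_open) (auto simp: I_def)
    then show "\<forall>\<^sub>F y in nhds (\<sigma> s). \<sigma> (\<eta> y) = y"
      by eventually_elim (auto simp: I_def \<eta>\<sigma>)
  qed
  have reparam: "((\<lambda>y. \<gamma> (\<eta> y)) has_vector_derivative (1 / g s) *\<^sub>R v) (at (\<sigma> s))"
    if s: "s \<in> J" and "(\<gamma> has_vector_derivative v) (at s)" for s v and \<gamma> :: "real \<Rightarrow> real ^ 3"
    using vector_diff_chain_at[OF \<eta>'[OF s, unfolded has_real_derivative_iff_has_vector_derivative], of \<gamma> v]
      that by (simp add: \<eta>\<sigma> o_def)
  define c d where "c s = 1 / g s" and "d s = a * \<tau> s / g s" for s
  have g': "(g has_real_derivative \<kappa> s * (a * \<tau> s) * g s) (at s)" if s: "s \<in> J" for s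
  proof -
    have "((\<lambda>s. 1 + (a * \<tau> s)\<^sup>2) has_real_derivative
        2 * (a * \<tau> s) * (a * (\<kappa> s / a * (1 + a\<^sup>2 * (\<tau> s)\<^sup>2)))) (at s)"
      by (rule derivative_eq_intros ode[OF s] refl | simp)+
    also have "2 * (a * \<tau> s) * (a * (\<kappa> s / a * (1 + a\<^sup>2 * (\<tau> s)\<^sup>2))) = 2 * (a * \<tau> s) * \<kappa> s * (g s * g s)"
      unfolding g_sq using \<open>a \<noteq> 0\<close> by (simp add: power_mult_distrib)
    finally have "(g has_real_derivative
        inverse (sqrt (1 + (a * \<tau> s)\<^sup>2)) / 2 * (2 * (a * \<tau> s) * \<kappa> s * (g s * g s))) (at s)"
      unfolding g_def[abs_def] 
      by (rule DERIV_chain2[where g = "\<lambda>s. 1 + (a * \<tau> s)\<^sup>2", OF DERIV_real_sqrt[OF sq_pos[of s]]])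
    moreover have "inverse (sqrt (1 + (a * \<tau> s)\<^sup>2)) / 2 * (2 * (a * \<tau> s) * \<kappa> s * (g s * g s))
        = \<kappa> s * (a * \<tau> s) * g s"
      using g_pos[of s] by (subst g_def[symmetric]) (simp add: field_simps)
    ultimately show ?thesis by (simp only:)
  qed
  have c': "(c has_real_derivative - (\<kappa> s * d s)) (at s)" if s: "s \<in> J" for s
  proof -
    have "(c has_real_derivative (0 * g s - 1 * (\<kappa> s * (a * \<tau> s) * g s)) / (g s * g s)) (at s)"
      unfolding c_def[abs_def] using g_pos[of s] by (intro DERIV_divide DERIV_const g' s) auto
    then show ?thesis
      using g_pos[of s] by (simp add: d_def field_simps)
  qed
  have d': "(d has_real_derivative \<kappa> s * c s) (at s)" if s: "s \<in> J" for s
  proof -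
    have "(d has_real_derivative (a * (\<kappa> s / a * (1 + a\<^sup>2 * (\<tau> s)\<^sup>2)) * g s
        - a * \<tau> s * (\<kappa> s * (a * \<tau> s) * g s)) / (g s * g s)) (at s)"
      unfolding d_def[abs_def] using g_pos[of s] by (intro DERIV_divide DERIV_cmult ode g' s) auto
    moreover have "(a * (\<kappa> s / a * (1 + a\<^sup>2 * (\<tau> s)\<^sup>2)) * g s
        - a * \<tau> s * (\<kappa> s * (a * \<tau> s) * g s)) / (g s * g s) = \<kappa> s * c s"
      using g_pos[of s] \<open>a \<noteq> 0\<close> by (simp add: c_def field_simps power2_eq_square)
    ultimately show ?thesis by simp
  qed
  have cd: "c s * c s + d s * d s = 1" for s
  proof -
    have "c s * c s + d s * d s = (1 + (a * \<tau> s)\<^sup>2) / (g s * g s)"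
      by (simp add: c_def d_def add_divide_distrib power2_eq_square)
    then show ?thesis using sq_pos[of s] by (simp add: g_sq)
  qed
  define \<Phi> V where "\<Phi> s = \<psi> s + a *\<^sub>R b s" and "V s = c s *\<^sub>R t s - d s *\<^sub>R n s" for s
  define \<phi> where "\<phi> y = \<Phi> (\<eta> y)" for y
  have \<Phi>': "(\<Phi> has_vector_derivative g s *\<^sub>R V s) (at s)" if s: "s \<in> J" for s
  proof -
    have "(\<Phi> has_vector_derivative t s + a *\<^sub>R (- \<tau> s *\<^sub>R n s)) (at s)"
      unfolding \<Phi>_def
      by (intro has_vector_derivative_add \<psi>_deriv s
          bounded_linear.has_vector_derivative[OF bounded_linear_scaleR_right b_deriv])
    then show ?thesis
      using g_pos[of s] by (simp add: V_def c_def d_def scaleR_diff_right)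
  qed
  have V': "(V has_vector_derivative - (d s * \<tau> s) *\<^sub>R b s) (at s)" if s: "s \<in> J" for s
  proof -
    have "(V has_vector_derivative (c s *\<^sub>R (\<kappa> s *\<^sub>R n s) + (- (\<kappa> s * d s)) *\<^sub>R t s)
        - (d s *\<^sub>R (- \<kappa> s *\<^sub>R t s + \<tau> s *\<^sub>R b s) + (\<kappa> s * c s) *\<^sub>R n s)) (at s)"
      unfolding V_def
      by (intro has_vector_derivative_diff has_vector_derivative_scaleR c' d' t_deriv n_deriv s)
    then show ?thesis by (simp add: algebra_simps)
  qed
  have T: "frame_T \<phi> (\<sigma> s) = V s" if s: "s \<in> J" for s
    using vector_derivative_at[OF reparam[OF s \<Phi>'[OF s]]] g_pos[of s]
    by (simp add: frame_T_def \<phi>_def[abs_def])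
  have N: "frame_N \<phi> (\<sigma> s) = - (d s * \<tau> s / g s) *\<^sub>R b s" if s: "s \<in> J" for s
  proof -
    have "(frame_T \<phi> has_vector_derivative (1 / g s) *\<^sub>R (- (d s * \<tau> s) *\<^sub>R b s)) (at (\<sigma> s))"
      by (rule has_vector_derivative_transform_within_open[OF reparam[OF s V'[OF s]] I(1)])
        (use s in \<open>auto simp: I_def T \<eta>\<sigma>\<close>)
    from vector_derivative_at[OF this] show ?thesis
      by (simp add: frame_N_def)
  qed
  have "arclength_curve I \<phi>"
    unfolding arclength_curve_def
  proof (intro conjI I ballI)
    show "real_analytic_on I \<phi>"
      unfolding real_analytic_on_curve_iff
    proof
      fix y assume "y \<in> I"
      then obtain s where s: "s \<in> J" "y = \<sigma> s" by (auto simp: I_def)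
      have "curve_analytic_at \<Phi> s"
        unfolding \<Phi>_def
        by (intro curve_analytic_at_add curve_analytic_at_scaleR real_analytic_at_const
            arclength_curve_frame(1)[OF arclength] b_analytic s)
      then show "curve_analytic_at \<phi> y"
        unfolding \<phi>_def s(2) using curve_analytic_at_compose[OF \<eta>_analytic[OF s(1)], of \<Phi>]
        by (simp add: \<eta>\<sigma> s(1))
    qed
    show "norm (frame_T \<phi> y) = 1" if "y \<in> I" for y
    proof -
      obtain s where s: "s \<in> J" "y = \<sigma> s" using \<open>y \<in> I\<close> by (auto simp: I_def)
      have "V s \<bullet> V s = 1"
        using cd[of s] t_n[OF s(1)]
        by (simp add: V_def inner_diff_left inner_diff_right t_unit n_unit s inner_commute[of "n s" "t s"])
      then show ?thesis by (simp add: norm_eq_1 T s)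
    qed
    \<comment> \<open>the normal of \<open>\<phi>\<close> is not identically zero: for \<open>\<tau> = 0\<close> the equation would read \<open>0 = \<kappa> / a\<close>\<close>
    have "\<exists>s\<in>J. \<tau> s \<noteq> 0"
    proof (rule ccontr)
      assume "\<not> (\<exists>s\<in>J. \<tau> s \<noteq> 0)"
      then have \<tau>0: "\<tau> s = 0" if "s \<in> J" for s using that by blast
      obtain s0 where s0: "s0 \<in> J" using J(3) by blast
      obtain s where s: "s \<in> J" "\<kappa> s \<noteq> 0"
        using eventually_happens[OF curvature_isolated_zeros[OF s0]] by auto
      have "((\<lambda>_. 0) has_real_derivative \<kappa> s / a * (1 + a\<^sup>2 * (\<tau> s)\<^sup>2)) (at s)"
        by (rule has_field_derivative_transform_within_open[OF ode[OF s(1)] J(1) s(1) \<tau>0])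
      then have "\<kappa> s / a * (1 + a\<^sup>2 * (\<tau> s)\<^sup>2) = 0"
        using DERIV_unique[OF _ DERIV_const] by blast
      then show False using s \<open>a \<noteq> 0\<close> by (simp add: \<tau>0)
    qed
    then obtain s where s: "s \<in> J" "\<tau> s \<noteq> 0" by blast
    moreover have "b s \<noteq> 0" using b_unit[OF s(1)] by auto
    ultimately have "frame_N \<phi> (\<sigma> s) \<noteq> 0"
      using \<open>a \<noteq> 0\<close> g_pos[of s] by (simp add: N d_def)
    then show "\<exists>y\<in>I. frame_N \<phi> y \<noteq> 0"
      using s(1) by (auto simp: I_def)
  qed
  moreover have "principal_normal_line \<phi> (\<sigma> s) = binormal_line \<psi> s"
    if s: "s \<in> J" and nz: "frame_N \<phi> (\<sigma> s) \<noteq> 0" "frame_B \<psi> s \<noteq> 0" for s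
  proof -
    define k where "k = - (d s * \<tau> s / g s)"
    have Nk: "frame_N \<phi> (\<sigma> s) = k *\<^sub>R b s" and k: "k \<noteq> 0" and \<kappa>: "\<kappa> s \<noteq> 0"
      using nz by (auto simp: N s k_def frame_B_eq)
    have \<phi>s: "\<phi> (\<sigma> s) = \<psi> s + a *\<^sub>R b s" by (simp add: \<phi>_def \<Phi>_def \<eta>\<sigma> s)
    have "\<phi> (\<sigma> s) + u *\<^sub>R frame_N \<phi> (\<sigma> s) = \<psi> s + ((a + u * k) / \<kappa> s) *\<^sub>R frame_B \<psi> s" for u
      using \<kappa> by (simp add: \<phi>s Nk frame_B_eq s scaleR_add_left)
    moreover have "\<psi> s + u *\<^sub>R frame_B \<psi> s = \<phi> (\<sigma> s) + ((u * \<kappa> s - a) / k) *\<^sub>R frame_N \<phi> (\<sigma> s)" for u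
      using k by (simp add: \<phi>s Nk frame_B_eq s scaleR_diff_left)
    ultimately show ?thesis
      unfolding principal_normal_line_def binormal_line_def by blast
  qed
  moreover have "\<sigma> differentiable_on J"
    using \<sigma>' by (meson differentiable_at_withinI differentiable_on_def real_differentiable_def)
  moreover have "bij_betw \<sigma> J I"
    using inj by (simp add: bij_betw_def I_def)
  ultimately show ?thesis
    using arclength unfolding mannheim_pair_def by blast
qed

end

theorem theorem3p3:
  fixes J :: "real set" and \<psi> :: "real \<Rightarrow> real ^ 3" and \<kappa> :: "real \<Rightarrow> real"
  assumes "arclength_curve J \<psi>"
    and "is_curvature J \<psi> \<kappa>"
  shows "(\<exists>I \<phi>. mannheim_pair I \<phi> J \<psi>) \<longleftrightarrow>
    (\<exists>a. a \<noteq> 0 \<and>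
      (\<forall>s\<in>J. (torsion \<psi> has_real_derivative
                 \<kappa> s / a * (1 + a\<^sup>2 * (torsion \<psi> s)\<^sup>2)) (at s)))"
proof -
  obtain n where "frenet_curve J \<psi> \<kappa> n"
    by (rule frenet_curve_exists[OF assms])
  then interpret frenet_curve J \<psi> \<kappa> n .
  show ?thesis
    using mannheim_imp_torsion_ode torsion_ode_imp_mannheim by blast
qed

end
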